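(* Let $y_1(\cdot),\dots,y_n(\cdot)\in\mathbb H^p$ be (centered) observations and $r$ a given number of factors. Let $\widehat R$, $\widetilde\Sigma_\varepsilon$, $\widehat Q$ be as defined in the context, and let $\widehat R^{A}$ and $\widetilde\Sigma_\varepsilon^{A}$ be obtained by applying adaptive functional thresholding (AFT) to $\widehat R$ and to $\widetilde\Sigma_\varepsilon$, respectively. Define the FPOET estimator and the constrained least squares estimator by $$\widehat\Sigma_y^{F}(u,v)=\sum_{j=1}^{r}\hat\tau_j\widehat\varphi_j(u)\widehat\varphi_j(v)^{T}+\widehat R^{A}(u,v),\qquad \widehat\Sigma_y^{L}(u,v)=\widehat Q(u)\widehat Q(v)^{T}+\widetilde\Sigma_\varepsilon^{A}(u,v).$$ Suppose that the same regularization parameters are used when applying AFT to $\widehat R$ and to $\widetilde\Sigma_\varepsilon$. Then $\widehat\Sigma_y^{F}=\widehat\Sigma_y^{L}$ and $\widehat R^{A}=\widetilde\Sigma_\varepsilon^{A}$.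
   Context: $\mathcal U$ is a compact interval, $\mathbb H=L_2(\mathcal U)$, $\mathbb S=\mathbb H\otimes\mathbb H$ (square-integrable kernels on $\mathcal U^2$) with Hilbert–Schmidt norm $\|K\|_{\mathcal S}=(\iint K^2)^{1/2}$; $\|f\|=(\int f^{T}f)^{1/2}$ for $f\in\mathbb H^p$; $\|\cdot\|_F$ is the Frobenius norm. Sample covariance: $\widehat\Sigma_y^{S}(u,v)=n^{-1}\sum_{t=1}^{n}y_t(u)y_t(v)^{T}$, with eigenvalues $\hat\tau_1\ge\hat\tau_2\ge\dots\ge0$ and corresponding orthonormal eigenfunctions $\widehat\varphi_j(\cdot)$ (as an integral operator on $\mathbb H^p$). The functional principal orthogonal complement is $\widehat R(u,v)=\sum_{j\ge r+1}\hat\tau_j\widehat\varphi_j(u)\widehat\varphi_j(v)^{T}$. Constrained least squares: with $Y(\cdot)=\{y_1(\cdot),\dots,y_n(\cdot)\}$ and $\Gamma^{T}=(\gamma_1,\dots,\gamma_n)\in\mathbb R^{r\times n}$, $\{\widehat Q(\cdot),\widehat\Gamma\}$ minimizes $\int\|Y(u)-Q(u)\Gamma^{T}\|_F^2\,du=\sum_{t=1}^n\|y_t-Q\gamma_t\|^2$ over $Q(\cdot)$ and $\Gamma$, subject to $n^{-1}\sum_t\gamma_t\gamma_t^{T}=I_r$ and $p^{-1}\int Q(u)^{T}Q(u)\,du$ diagonal. Explicitly, the columns of $n^{-1/2}\widehat\Gamma$ are the eigenvectors corresponding to the $r$ largest eigenvalues of $\int Y(u)^{T}Y(u)\,du\in\mathbb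 R^{n\times n}$, and $\widehat Q(\cdot)=n^{-1}Y(\cdot)\widehat\Gamma$. With $\widehat\Gamma^{T}=(\widehat\gamma_1,\dots,\widehat\gamma_n)$, put $\widetilde\varepsilon_t(\cdot)=y_t(\cdot)-\widehat Q(\cdot)\widehat\gamma_t$ and $\widetilde\Sigma_\varepsilon(u,v)=n^{-1}\sum_{t=1}^n\widetilde\varepsilon_t(u)\widetilde\varepsilon_t(v)^{T}$. AFT: for a sample covariance $\widehat\Sigma_\varepsilon=(\widehat\Sigma_{\varepsilon,ij})_{p\times p}$ of estimated idiosyncratic errors $\widehat\varepsilon_t=(\widehat\varepsilon_{t1},\dots,\widehat\varepsilon_{tp})^{T}$, put $\widehat\Theta_{ij}(u,v)=n^{-1}\sum_{t=1}^n\{\widehat\varepsilon_{ti}(u)\widehat\varepsilon_{tj}(v)-\widehat\Sigma_{\varepsilon,ij}(u,v)\}^2$; the AFT estimator has entries $\|\widehat\Theta_{ij}^{1/2}\|_{\mathcal S}\,s_\lambda(\widehat\Sigma_{\varepsilon,ij}/\|\widehat\Theta_{ij}^{1/2}\|_{\mathcal S})$ with regularization parameter $\lambda=\dot C(\sqrt{\log p/n}+1/\sqrt p)$, $\dot C>0$. Here $s_\lambda:\mathbb S\to\mathbb S$ is a functional thresholding operator, i.e. (1) $\|s_\lambda(Z)\|_{\mathcal S}\le c\|Y\|_{\mathcal S}$ for all $Z,Y\in\mathbb S$ with $\|Z-Y\|_{\mathcal S}\le\lambda$ and some $c>0$; (2) $\|s_\lambda(Z)\|_{\mathcal S}=0$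 if $\|Z\|_{\mathcal S}\le\lambda$; (3) $\|s_\lambda(Z)-Z\|_{\mathcal S}\le\lambda$ for all $Z\in\mathbb S$. This procedure is applied to $\widehat R$ and to $\widetilde\Sigma_\varepsilon$ in place of $\widehat\Sigma_\varepsilon$.
   Formalization: Equality for all choices of eigenfunctions and minimizers is claimed only if no positive τ̂_j (j≤r) equals τ̂_{r+1}; with such a tie, each choice on one side has a matching choice on the other. Also 1≤r≤n is assumed, and equality is almost everywhere. *)

theory Defs
  imports "HOL-Analysis.Analysis"
begin

text \<open>
  Throughout, \<open>M\<close> is Lebesgue measure on a compact interval. Elements of \<open>L2\<close> spaces are
  represented by functions, so equality in these spaces is equality almost everywhere.
  The dimension \<open>p\<close>, the sample size \<open>n\<close> and the number of factors \<open>r\<close> are the cardinalities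
  of the index types \<open>'p\<close>, \<open>'n\<close> and \<open>'r\<close>. A kernel is a function of the pair \<open>(u, v)\<close>.
\<close>

definition L2 :: "'x measure \<Rightarrow> ('x \<Rightarrow> 'b::euclidean_space) set" where
  "L2 M = {f \<in> borel_measurable M. integrable M (\<lambda>x. (norm (f x))\<^sup>2)}"

definition L2_inner :: "'x measure \<Rightarrow> ('x \<Rightarrow> 'b::euclidean_space) \<Rightarrow> ('x \<Rightarrow> 'b) \<Rightarrow> real" where
  "L2_inner M f g = (\<integral>x. f x \<bullet> g x \<partial>M)"

definition HS_norm :: "real measure \<Rightarrow> (real \<times> real \<Rightarrow> real) \<Rightarrow> real" where
  "HS_norm M K = sqrt (\<integral>z. (K z)\<^sup>2 \<partial>(M \<Otimes>\<^sub>M M))"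

definition kernel_eq :: "real measure \<Rightarrow> (real \<times> real \<Rightarrow> 'b) \<Rightarrow> (real \<times> real \<Rightarrow> 'b) \<Rightarrow> bool" where
  "kernel_eq M K L \<longleftrightarrow> (AE z in M \<Otimes>\<^sub>M M. K z = L z)"

definition outer :: "real^'p \<Rightarrow> real^'p \<Rightarrow> real^'p^'p" where
  "outer x y = (\<chi> i j. x $ i * y $ j)"

definition sample_cov :: "('n::finite \<Rightarrow> real \<Rightarrow> real^'p) \<Rightarrow> real \<times> real \<Rightarrow> real^'p^'p" where
  "sample_cov y = (\<lambda>(u, v). (1 / real CARD('n)) *\<^sub>R (\<Sum>t\<in>UNIV. outer (y t u) (y t v)))"

definition integral_op ::
  "real measure \<Rightarrow> (real \<times> real \<Rightarrow> real^'p^'p) \<Rightarrow> (real \<Rightarrow> real^'p::finite) \<Rightarrow> real \<Rightarrow> real^'p" where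
  "integral_op M K f u = (\<integral>v. K (u, v) *v f v \<partial>M)"

text \<open>
  Indices start at 0, so \<open>\<tau> j\<close> is the \<open>(j + 1)\<close>-st largest eigenvalue. The last conjunct says
  that all nonzero eigenvalues are listed, with their full multiplicities.
\<close>

definition eigensystem ::
  "real measure \<Rightarrow> (real \<times> real \<Rightarrow> real^'p^'p) \<Rightarrow> (nat \<Rightarrow> real) \<Rightarrow> (nat \<Rightarrow> real \<Rightarrow> real^'p::finite) \<Rightarrow> bool"
  where
  "eigensystem M K \<tau> \<phi> \<longleftrightarrow>
     decseq \<tau> \<and> (\<forall>j. 0 \<le> \<tau> j) \<and>
     (\<forall>j. \<phi> j \<in> L2 M) \<and>
     (\<forall>i j. L2_inner M (\<phi> i) (\<phi> j) = (if i = j then 1 else 0)) \<and>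
     (\<forall>j. AE u in M. integral_op M K (\<phi> j) u = \<tau> j *\<^sub>R \<phi> j u) \<and>
     (\<forall>f \<in> L2 M. (\<forall>j. L2_inner M f (\<phi> j) = 0) \<longrightarrow> (AE u in M. integral_op M K f u = 0))"

definition leading_part ::
  "nat \<Rightarrow> (nat \<Rightarrow> real) \<Rightarrow> (nat \<Rightarrow> real \<Rightarrow> real^'p) \<Rightarrow> real \<times> real \<Rightarrow> real^'p^'p" where
  "leading_part r \<tau> \<phi> = (\<lambda>(u, v). \<Sum>j<r. \<tau> j *\<^sub>R outer (\<phi> j u) (\<phi> j v))"

text \<open>
  For a sample covariance only finitely many eigenvalues are nonzero, so the series below is
  a finite sum at every point.
\<close>

definition orth_complement ::
  "nat \<Rightarrow> (nat \<Rightarrow> real) \<Rightarrow> (nat \<Rightarrow> real \<Rightarrow> real^'p::finite) \<Rightarrow> real \<times> real \<Rightarrow> real^'p^'p" where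
  "orth_complement r \<tau> \<phi> = (\<lambda>(u, v). \<Sum>j. \<tau> (r + j) *\<^sub>R outer (\<phi> (r + j) u) (\<phi> (r + j) v))"

text \<open>
  The estimated idiosyncratic errors whose sample covariance is \<open>orth_complement\<close>: the
  observations minus their projections onto the leading \<open>r\<close> eigenfunctions.
\<close>

definition pc_residual ::
  "real measure \<Rightarrow> ('n \<Rightarrow> real \<Rightarrow> real^'p::finite) \<Rightarrow> nat \<Rightarrow> (nat \<Rightarrow> real \<Rightarrow> real^'p)
     \<Rightarrow> 'n \<Rightarrow> real \<Rightarrow> real^'p" where
  "pc_residual M y r \<phi> t u = y t u - (\<Sum>j<r. L2_inner M (y t) (\<phi> j) *\<^sub>R \<phi> j u)"

text \<open>
  The \<open>p \<times> n\<close> matrix \<open>Y(u)\<close> has columns \<open>y\<^sub>t(u)\<close>; the rows of \<open>\<Gamma>\<close> are the \<open>\<gamma>\<^sub>t\<close>. The norm of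
  \<open>real^'n^'p\<close> is the Frobenius norm.
\<close>

definition data_matrix :: "('n \<Rightarrow> real \<Rightarrow> real^'p) \<Rightarrow> real \<Rightarrow> real^'n^'p" where
  "data_matrix y u = (\<chi> i t. y t u $ i)"

definition cls_objective ::
  "real measure \<Rightarrow> ('n::finite \<Rightarrow> real \<Rightarrow> real^'p::finite) \<Rightarrow> (real \<Rightarrow> real^'r^'p) \<Rightarrow> real^'r::finite^'n \<Rightarrow> real"
  where
  "cls_objective M y Q \<Gamma> = (\<integral>u. (norm (data_matrix y u - Q u ** transpose \<Gamma>))\<^sup>2 \<partial>M)"

definition cls_feasible ::
  "real measure \<Rightarrow> (real \<Rightarrow> real^'r::finite^'p::finite) \<Rightarrow> real^'r^'n::finite \<Rightarrow> bool" where
  "cls_feasible M Q \<Gamma> \<longleftrightarrow>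
     Q \<in> L2 M \<and>
     (1 / real CARD('n)) *\<^sub>R (transpose \<Gamma> ** \<Gamma>) = mat 1 \<and>
     (\<forall>k l. k \<noteq> l \<longrightarrow>
        ((1 / real CARD('p)) *\<^sub>R (\<integral>u. transpose (Q u) ** Q u \<partial>M)) $ k $ l = 0)"

definition cls_solution ::
  "real measure \<Rightarrow> ('n::finite \<Rightarrow> real \<Rightarrow> real^'p::finite) \<Rightarrow> (real \<Rightarrow> real^'r^'p) \<Rightarrow> real^'r::finite^'n \<Rightarrow> bool"
  where
  "cls_solution M y Q \<Gamma> \<longleftrightarrow>
     cls_feasible M Q \<Gamma> \<and>
     (\<forall>(Q' :: real \<Rightarrow> real^'r^'p) (\<Gamma>' :: real^'r^'n).
        cls_feasible M Q' \<Gamma>' \<longrightarrow> cls_objective M y Q \<Gamma> \<le> cls_objective M y Q' \<Gamma>')"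

definition cls_residual ::
  "('n::finite \<Rightarrow> real \<Rightarrow> real^'p) \<Rightarrow> (real \<Rightarrow> real^'r::finite^'p) \<Rightarrow> real^'r^'n \<Rightarrow> 'n \<Rightarrow> real \<Rightarrow> real^'p"
  where
  "cls_residual y Q \<Gamma> t u = y t u - Q u *v (\<Gamma> $ t)"

text \<open>
  The second conjunct makes \<open>s\<close> well defined on almost-everywhere equivalence classes.
\<close>

definition functional_thresholding ::
  "real measure \<Rightarrow> real \<Rightarrow> ((real \<times> real \<Rightarrow> real) \<Rightarrow> real \<times> real \<Rightarrow> real) \<Rightarrow> bool" where
  "functional_thresholding M lam s \<longleftrightarrow>
     (\<forall>Z \<in> L2 (M \<Otimes>\<^sub>M M). s Z \<in> L2 (M \<Otimes>\<^sub>M M)) \<and>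
     (\<forall>Z \<in> L2 (M \<Otimes>\<^sub>M M). \<forall>Y \<in> L2 (M \<Otimes>\<^sub>M M). kernel_eq M Z Y \<longrightarrow> kernel_eq M (s Z) (s Y)) \<and>
     (\<exists>c>0. \<forall>Z \<in> L2 (M \<Otimes>\<^sub>M M). \<forall>Y \<in> L2 (M \<Otimes>\<^sub>M M).
        HS_norm M (\<lambda>z. Z z - Y z) \<le> lam \<longrightarrow> HS_norm M (s Z) \<le> c * HS_norm M Y) \<and>
     (\<forall>Z \<in> L2 (M \<Otimes>\<^sub>M M). HS_norm M Z \<le> lam \<longrightarrow> HS_norm M (s Z) = 0) \<and>
     (\<forall>Z \<in> L2 (M \<Otimes>\<^sub>M M). HS_norm M (\<lambda>z. s Z z - Z z) \<le> lam)"

definition variance_factor ::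
  "('n::finite \<Rightarrow> real \<Rightarrow> real^'p) \<Rightarrow> (real \<times> real \<Rightarrow> real^'p^'p) \<Rightarrow> 'p \<Rightarrow> 'p \<Rightarrow> real \<times> real \<Rightarrow> real" where
  "variance_factor \<epsilon> S i j = (\<lambda>(u, v).
     (1 / real CARD('n)) * (\<Sum>t\<in>UNIV. (\<epsilon> t u $ i * \<epsilon> t v $ j - S (u, v) $ i $ j)\<^sup>2))"

text \<open>
  If the norm \<open>w\<close> vanishes, the entry is 0 by the convention \<open>x / 0 = 0\<close>.
\<close>

definition AFT ::
  "real measure \<Rightarrow> ((real \<times> real \<Rightarrow> real) \<Rightarrow> real \<times> real \<Rightarrow> real) \<Rightarrow>
   ('n::finite \<Rightarrow> real \<Rightarrow> real^'p) \<Rightarrow> (real \<times> real \<Rightarrow> real^'p^'p) \<Rightarrow> real \<times> real \<Rightarrow> real^'p^'p" where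
  "AFT M s \<epsilon> S = (\<lambda>z. \<chi> i j.
     let w = HS_norm M (\<lambda>z'. sqrt (variance_factor \<epsilon> S i j z'))
     in w * s (\<lambda>z'. S z' $ i $ j / w) z)"

definition fpoet_R_AFT ::
  "real measure \<Rightarrow> ((real \<times> real \<Rightarrow> real) \<Rightarrow> real \<times> real \<Rightarrow> real) \<Rightarrow> ('n::finite \<Rightarrow> real \<Rightarrow> real^'p::finite)
   \<Rightarrow> nat \<Rightarrow> (nat \<Rightarrow> real) \<Rightarrow> (nat \<Rightarrow> real \<Rightarrow> real^'p) \<Rightarrow> real \<times> real \<Rightarrow> real^'p^'p" where
  "fpoet_R_AFT M s y r \<tau> \<phi> = AFT M s (pc_residual M y r \<phi>) (orth_complement r \<tau> \<phi>)"

definition fpoet ::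
  "real measure \<Rightarrow> ((real \<times> real \<Rightarrow> real) \<Rightarrow> real \<times> real \<Rightarrow> real) \<Rightarrow> ('n::finite \<Rightarrow> real \<Rightarrow> real^'p::finite)
   \<Rightarrow> nat \<Rightarrow> (nat \<Rightarrow> real) \<Rightarrow> (nat \<Rightarrow> real \<Rightarrow> real^'p) \<Rightarrow> real \<times> real \<Rightarrow> real^'p^'p" where
  "fpoet M s y r \<tau> \<phi> = (\<lambda>z. leading_part r \<tau> \<phi> z + fpoet_R_AFT M s y r \<tau> \<phi> z)"

definition cls_error_AFT ::
  "real measure \<Rightarrow> ((real \<times> real \<Rightarrow> real) \<Rightarrow> real \<times> real \<Rightarrow> real) \<Rightarrow> ('n::finite \<Rightarrow> real \<Rightarrow> real^'p::finite)
   \<Rightarrow> (real \<Rightarrow> real^'r::finite^'p) \<Rightarrow> real^'r^'n \<Rightarrow> real \<times> real \<Rightarrow> real^'p^'p" where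
  "cls_error_AFT M s y Q \<Gamma> = AFT M s (cls_residual y Q \<Gamma>) (sample_cov (cls_residual y Q \<Gamma>))"

definition cls_estimator ::
  "real measure \<Rightarrow> ((real \<times> real \<Rightarrow> real) \<Rightarrow> real \<times> real \<Rightarrow> real) \<Rightarrow> ('n::finite \<Rightarrow> real \<Rightarrow> real^'p::finite)
   \<Rightarrow> (real \<Rightarrow> real^'r::finite^'p) \<Rightarrow> real^'r^'n \<Rightarrow> real \<times> real \<Rightarrow> real^'p^'p" where
  "cls_estimator M s y Q \<Gamma> = (\<lambda>(u, v). Q u ** transpose (Q v) + cls_error_AFT M s y Q \<Gamma> (u, v))"

end

theory Submission
  imports Defs
begin

text \<open>
  Everything is governed by the \<open>n \<times> n\<close> Gram matrix \<open>G = n\<^sup>-\<^sup>1 \<integral> Y\<^sup>T Y\<close>. It has the same nonzero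
  eigenvalues \<open>\<tau>\<^sub>j\<close> as the sample covariance operator, and unit eigenvectors \<open>w\<^sub>j\<close> of \<open>G\<close> correspond to
  eigenfunctions through \<open>\<langle>y\<^sub>t, \<phi>\<^sub>j\<rangle> = \<surd>(n \<tau>\<^sub>j) w\<^sub>j\<^sub>t\<close>. For scores \<open>\<Gamma>\<close> with \<open>\<Gamma>\<^sup>T \<Gamma> = n I\<close> the least squares
  objective is \<open>\<Sum>\<^sub>t \<parallel>y\<^sub>t\<parallel>\<^sup>2 - n tr (P G) + n \<parallel>Q - n\<^sup>-\<^sup>1 Y \<Gamma>\<parallel>\<^sup>2\<close>, where \<open>P\<close> is the orthogonal projection onto
  the column space of \<open>\<Gamma>\<close>. Hence \<open>Q = n\<^sup>-\<^sup>1 Y \<Gamma>\<close> at a minimum, and \<open>P\<close> attains Ky Fan's bound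
  \<open>tr (P G) \<le> \<tau>\<^sub>0 + \<dots> + \<tau>\<^sub>r\<^sub>-\<^sub>1\<close>. If \<open>P\<close> is the projection onto the leading \<open>w\<^sub>j\<close> (up to eigenvalue 0),
  then both methods have the same residuals and \<open>Q Q\<^sup>T\<close> is the leading part of the spectral
  decomposition. This is forced by a spectral gap; without a gap, equality in Ky Fan's bound still
  makes \<open>P\<close> commute with \<open>G\<close>, so that some sorted eigenbasis is adapted to \<open>P\<close>.
\<close>

section \<open>Orthonormal families and the spectral theorem\<close>

definition orthonormal_on :: "'i set \<Rightarrow> ('i \<Rightarrow> 'a::real_inner) \<Rightarrow> bool" where
  "orthonormal_on I w \<longleftrightarrow> (\<forall>i\<in>I. \<forall>j\<in>I. w i \<bullet> w j = (if i = j then 1 else 0))"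

lemma orthonormal_onD:
  "orthonormal_on I w \<Longrightarrow> i \<in> I \<Longrightarrow> j \<in> I \<Longrightarrow> w i \<bullet> w j = (if i = j then 1 else 0)"
  by (simp add: orthonormal_on_def)

lemma orthonormal_on_inj: "orthonormal_on I w \<Longrightarrow> inj_on w I"
  by (rule inj_onI) (metis orthonormal_onD zero_neq_one)

lemma orthonormal_on_pairwise: "orthonormal_on I w \<Longrightarrow> pairwise orthogonal (w ` I)"
  by (auto simp: pairwise_def orthogonal_def orthonormal_on_def)

lemma orthonormal_on_norm: "orthonormal_on I w \<Longrightarrow> i \<in> I \<Longrightarrow> norm (w i) = 1"
  by (simp add: orthonormal_on_def norm_eq_1)

lemma orthonormal_on_independent:
  fixes w :: "'i \<Rightarrow> 'a::euclidean_space"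
  shows "orthonormal_on I w \<Longrightarrow> independent (w ` I)"
  by (rule pairwise_orthogonal_independent)
    (auto dest: orthonormal_on_pairwise orthonormal_on_norm)

lemma orthonormal_on_span_expand:
  fixes w :: "'i \<Rightarrow> 'a::euclidean_space"
  assumes "finite I" "orthonormal_on I w" "x \<in> span (w ` I)"
  shows "(\<Sum>i\<in>I. (w i \<bullet> x) *\<^sub>R w i) = x"
proof -
  have "(\<Sum>b\<in>w ` I. (x \<bullet> b) *\<^sub>R b) = x"
    using assms by (intro orthonormal_basis_expand)
      (auto dest: orthonormal_on_pairwise orthonormal_on_norm)
  then show ?thesis
    by (simp add: sum.reindex[OF orthonormal_on_inj[OF assms(2)]] inner_commute)
qed

lemma dim_span_orthonormal_on:
  fixes w :: "'i \<Rightarrow> 'a::euclidean_space"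
  assumes "orthonormal_on I w"
  shows "dim (span (w ` I)) = card I"
  using assms
  by (metis card_image dim_span dim_eq_card_independent orthonormal_on_independent orthonormal_on_inj)

lemma orthonormal_on_span_UNIV:
  fixes w :: "'i \<Rightarrow> 'a::euclidean_space"
  assumes "orthonormal_on I w" "card I = DIM('a)"
  shows "span (w ` I) = UNIV"
  using dim_span_orthonormal_on[OF assms(1)] assms(2) by (metis dim_eq_full span_span)

lemma card_orthogonal_nonzero_le:
  fixes v :: "'i \<Rightarrow> 'a::euclidean_space"
  assumes "\<And>i j. i \<in> I \<Longrightarrow> j \<in> I \<Longrightarrow> i \<noteq> j \<Longrightarrow> v i \<bullet> v j = 0" "\<And>i. i \<in> I \<Longrightarrow> v i \<noteq> 0" "finite I"
  shows "card I \<le> DIM('a)"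
proof -
  have "independent (v ` I)"
    using assms by (intro pairwise_orthogonal_independent) (auto simp: pairwise_def orthogonal_def)
  moreover have "inj_on v I"
    by (rule inj_onI) (metis assms(1,2) inner_eq_zero_iff)
  ultimately show ?thesis
    using independent_bound[of "v ` I"] by (simp add: card_image)
qed

lemma orthonormal_on_parseval:
  fixes w :: "'i \<Rightarrow> 'a::euclidean_space"
  assumes "finite I" "orthonormal_on I w" "card I = DIM('a)"
  shows "(\<Sum>i\<in>I. (w i \<bullet> x) * (w i \<bullet> y)) = x \<bullet> y"
proof -
  have "(\<Sum>i\<in>I. (w i \<bullet> x) *\<^sub>R w i) = x"
    using assms by (intro orthonormal_on_span_expand) (simp_all add: orthonormal_on_span_UNIV)
  then have "x \<bullet> y = (\<Sum>i\<in>I. (w i \<bullet> x) *\<^sub>R w i) \<bullet> y" by simp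
  then show ?thesis by (simp add: inner_sum_left)
qed

text \<open>While fewer than \<open>DIM('a)\<close> indices are in use, the span of the family is
  proper, and a normalized vector orthogonal to it serves the next index. The extension later
  supplies Gram eigenvectors for eigenvalue 0, where the loadings vanish and cannot be
  normalized.\<close>

lemma orthonormal_on_extend:
  fixes u :: "'i \<Rightarrow> 'a::euclidean_space"
  assumes "finite I" "orthonormal_on I u" "finite K" "I \<inter> K = {}" "card (I \<union> K) \<le> DIM('a)"
  shows "\<exists>w. orthonormal_on (I \<union> K) w \<and> (\<forall>i\<in>I. w i = u i)"
  using assms(3-5)
proof (induction K)
  case empty
  then show ?case using assms(2) by auto
next
  case (insert k K)
  have k: "k \<notin> I \<union> K" using insert by auto
  then have card: "card (I \<union> K) < DIM('a)" using insert assms(1) by simp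
  then obtain w where w: "orthonormal_on (I \<union> K) w" "\<forall>i\<in>I. w i = u i"
    using insert by auto
  have "dim (span (w ` (I \<union> K))) < DIM('a)"
    using dim_span_orthonormal_on[OF w(1)] card by simp
  then obtain x where x: "x \<noteq> 0" "\<And>y. y \<in> span (w ` (I \<union> K)) \<Longrightarrow> orthogonal x y"
    using orthogonal_to_subspace_exists[of "w ` (I \<union> K)"] by (auto simp: dim_span)
  define w' where "w' = w(k := x /\<^sub>R norm x)"
  have "x \<bullet> w i = 0" "w i \<bullet> x = 0" if "i \<in> I \<union> K" for i
    using x(2)[of "w i"] that by (auto simp: orthogonal_def inner_commute intro: span_base)
  moreover have "(x /\<^sub>R norm x) \<bullet> (x /\<^sub>R norm x) = 1"
    using x(1) unfolding norm_eq_1[symmetric] by simp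
  ultimately have "orthonormal_on (I \<union> insert k K) w'"
    using w(1) k by (auto simp: orthonormal_on_def w'_def simp del: inner_scaleR_left inner_scaleR_right)
      (simp_all add: inner_scaleR_left inner_scaleR_right)
  moreover have "\<forall>i\<in>I. w' i = u i" using w(2) k by (auto simp: w'_def)
  ultimately show ?case by blast
qed

section \<open>Rayleigh quotients and sorted eigenvectors of a symmetric operator\<close>

lemma eq_0_if_quadratically_dominated:
  fixes \<beta> \<gamma> :: real
  assumes "\<And>t. t * \<beta> \<le> t\<^sup>2 * \<gamma>"
  shows "\<beta> = 0"
proof (rule ccontr)
  assume "\<beta> \<noteq> 0"
  \<comment> \<open>This choice gives
    \<open>t * \<beta> = t\<^sup>2 * (\<bar>\<gamma>\<bar> + 1)\<close>, which exceeds
    \<open>t\<^sup>2 * \<bar>\<gamma>\<bar>\<close> by \<open>t\<^sup>2\<close>.\<close>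
  define t where "t = \<beta> / (\<bar>\<gamma>\<bar> + 1)"
  have "t * \<beta> \<le> t\<^sup>2 * \<bar>\<gamma>\<bar>"
    using assms[of t] by (smt (verit) mult_left_mono zero_le_power2)
  moreover have "\<beta> = t * (\<bar>\<gamma>\<bar> + 1)" "t \<noteq> 0"
    using \<open>\<beta> \<noteq> 0\<close> by (auto simp: t_def)
  ultimately have "t\<^sup>2 * (\<bar>\<gamma>\<bar> + 1) \<le> t\<^sup>2 * \<bar>\<gamma>\<bar>"
    by (simp add: power2_eq_square mult.assoc)
  with \<open>t \<noteq> 0\<close> show False by (simp add: algebra_simps)
qed

text \<open>The Rayleigh quotient attains its maximum on the compact unit sphere of
  \<open>S\<close>. At a maximizer the first-order variation in the direction of the defect
  \<open>G x - \<mu> *\<^sub>R x\<close> must vanish, and invariance of \<open>S\<close> makes this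
  direction admissible.\<close>

lemma rayleigh_maximizer_exists:
  fixes G :: "'a::euclidean_space \<Rightarrow> 'a"
  assumes lin: "linear G" and sym: "\<And>x y. G x \<bullet> y = x \<bullet> G y"
    and S: "subspace S" "\<And>x. x \<in> S \<Longrightarrow> G x \<in> S" and nz: "\<exists>x\<in>S. x \<noteq> 0"
  obtains x where "x \<in> S" "norm x = 1" "G x = (x \<bullet> G x) *\<^sub>R x"
    "\<And>y. y \<in> S \<Longrightarrow> norm y = 1 \<Longrightarrow> y \<bullet> G y \<le> x \<bullet> G x"
proof -
  have cont: "continuous_on A (\<lambda>x. x \<bullet> G x)" for A
    using lin by (intro continuous_intros linear_continuous_on linear_conv_bounded_linear[THEN iffD1])
  have comp: "compact (S \<inter> sphere 0 1)"
    using closed_subspace[OF S(1)] compact_sphere by (rule closed_Int_compact)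
  obtain z where z: "z \<in> S" "z \<noteq> 0" using nz by blast
  have "(1 / norm z) *\<^sub>R z \<in> S \<inter> sphere 0 1"
    using z S(1) by (auto intro: subspace_scale)
  then have "S \<inter> sphere 0 1 \<noteq> {}" by blast
  from continuous_attains_sup[OF comp this cont]
  obtain x where x: "x \<in> S" "norm x = 1"
    and max: "\<And>y. y \<in> S \<Longrightarrow> norm y = 1 \<Longrightarrow> y \<bullet> G y \<le> x \<bullet> G x"
    by auto
  define \<mu> where "\<mu> = x \<bullet> G x"
  have hom: "y \<bullet> G y \<le> \<mu> * (y \<bullet> y)" if "y \<in> S" for y
  proof (cases "y = 0")
    case False
    have "((1 / norm y) *\<^sub>R y) \<bullet> G ((1 / norm y) *\<^sub>R y) \<le> \<mu>"
      unfolding \<mu>_def using that False S(1) by (intro max) (auto intro: subspace_scale)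
    then have "(y \<bullet> G y) / (norm y)\<^sup>2 \<le> \<mu>"
      by (simp add: linear_cmul[OF lin] power2_eq_square)
    then show ?thesis using False by (simp add: divide_simps power2_norm_eq_inner)
  qed (simp add: linear_0[OF lin])
  define d where "d = G x - \<mu> *\<^sub>R x"
  have d: "d \<in> S" unfolding d_def using S x by (auto intro: subspace_diff subspace_scale)
  \<comment> \<open>In the expansion of \<open>hom\<close> at \<open>x + t *\<^sub>R d\<close> the
    linear coefficient is twice \<open>d \<bullet> G x - \<mu> * (d \<bullet> x)\<close>, which is
    \<open>d \<bullet> d\<close>. As \<open>t\<close> may have either sign, it has to be 0.\<close>
  have "t * (2 * (d \<bullet> d)) \<le> t\<^sup>2 * (\<mu> * (d \<bullet> d) - d \<bullet> G d)" for t :: real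
  proof -
    have "(x + t *\<^sub>R d) \<bullet> G (x + t *\<^sub>R d) \<le> \<mu> * ((x + t *\<^sub>R d) \<bullet> (x + t *\<^sub>R d))"
      using x d S(1) by (intro hom) (auto intro: subspace_add subspace_scale)
    moreover have "(x + t *\<^sub>R d) \<bullet> G (x + t *\<^sub>R d) = \<mu> + 2 * t * (d \<bullet> G x) + t\<^sup>2 * (d \<bullet> G d)"
    proof -
      have "x \<bullet> G d = d \<bullet> G x" using sym[of x d] by (simp add: inner_commute)
      then show ?thesis
      by (simp add: linear_add[OF lin] linear_cmul[OF lin] inner_add_left inner_add_right \<mu>_def
          power2_eq_square algebra_simps)
    qed
    moreover have "(x + t *\<^sub>R d) \<bullet> (x + t *\<^sub>R d) = 1 + 2 * t * (d \<bullet> x) + t\<^sup>2 * (d \<bullet> d)"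
      using x(2) by (simp add: norm_eq_1 inner_add_left inner_add_right power2_eq_square
          inner_commute algebra_simps)
    moreover have "d \<bullet> d = d \<bullet> G x - \<mu> * (d \<bullet> x)"
      by (subst (2) d_def) (simp add: inner_diff_right)
    ultimately have "\<mu> + 2 * t * (d \<bullet> G x) + t\<^sup>2 * (d \<bullet> G d) \<le> \<mu> * (1 + 2 * t * (d \<bullet> x) + t\<^sup>2 * (d \<bullet> d))"
      and "d \<bullet> G x = d \<bullet> d + \<mu> * (d \<bullet> x)" by simp_all
    then show ?thesis by (simp only:) (simp add: algebra_simps)
  qed
  from eq_0_if_quadratically_dominated[OF this] have "d = 0" by simp
  then show ?thesis using that[of x] x max by (simp add: d_def \<mu>_def)
qed

text \<open>Induction on the dimension: a Rayleigh maximizer heads the list, and by symmetry of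
  \<open>G\<close> its orthogonal complement in \<open>S\<close> is again invariant. Each head
  maximizes over all that follow it, so the list comes out sorted. Working inside an invariant
  subspace allows the later use on the span of the scores and on its complement separately.\<close>

lemma symmetric_sorted_eigenlist:
  fixes G :: "'a::euclidean_space \<Rightarrow> 'a"
  assumes lin: "linear G" and sym: "\<And>x y. G x \<bullet> y = x \<bullet> G y"
  shows "subspace S \<Longrightarrow> (\<And>x. x \<in> S \<Longrightarrow> G x \<in> S) \<Longrightarrow>
    \<exists>xs. length xs = dim S \<and> set xs \<subseteq> S \<and> orthonormal_on {..<length xs} ((!) xs) \<and>
      (\<forall>x\<in>set xs. norm x = 1 \<and> G x = (x \<bullet> G x) *\<^sub>R x) \<and> sorted_wrt (\<lambda>x y. y \<bullet> G y \<le> x \<bullet> G x) xs"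
proof (induction "dim S" arbitrary: S)
  case 0
  then show ?case by (intro exI[of _ "[]"]) (auto simp: orthonormal_on_def)
next
  case (Suc d)
  have "\<exists>x\<in>S. x \<noteq> 0"
    using Suc.hyps(2) by (metis dim_eq_0 insertCI nat.distinct(1) subsetI)
  then obtain x where x: "x \<in> S" "norm x = 1" "G x = (x \<bullet> G x) *\<^sub>R x"
    and max: "\<And>y. y \<in> S \<Longrightarrow> norm y = 1 \<Longrightarrow> y \<bullet> G y \<le> x \<bullet> G x"
    using rayleigh_maximizer_exists[OF lin sym Suc.prems] by metis
  define S' where "S' = {y \<in> S. x \<bullet> y = 0}"
  have S'_eq: "S' = {y \<in> S. \<forall>z\<in>span {x}. orthogonal z y}"
    by (auto simp: S'_def span_singleton orthogonal_def)
  have "dim S' + dim (span {x}) = dim S"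
    unfolding S'_eq using Suc.prems x(1)
    by (intro dim_subspace_orthogonal_to_vectors) (auto simp: span_minimal)
  moreover have "dim (span {x}) = 1"
    using x(2) by (auto simp: dim_span_eq_card_independent)
  ultimately have "d = dim S'" using Suc.hyps(2) by simp
  moreover have "subspace S'"
    using Suc.prems(1) by (auto simp: S'_def subspace_def inner_add_right)
  moreover have "G y \<in> S'" if "y \<in> S'" for y
  proof -
    have "x \<bullet> G y = (x \<bullet> G x) * (x \<bullet> y)"
      by (metis sym x(3) inner_scaleR_left)
    then show ?thesis using that Suc.prems(2) by (simp add: S'_def)
  qed
  ultimately have "\<exists>xs. length xs = dim S' \<and> set xs \<subseteq> S' \<and> orthonormal_on {..<length xs} ((!) xs) \<and>
      (\<forall>x\<in>set xs. norm x = 1 \<and> G x = (x \<bullet> G x) *\<^sub>R x) \<and> sorted_wrt (\<lambda>x y. y \<bullet> G y \<le> x \<bullet> G x) xs"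
    by (intro Suc.hyps(1))
  then obtain xs where xs: "length xs = d" "set xs \<subseteq> S'" "orthonormal_on {..<length xs} ((!) xs)"
      "\<forall>x\<in>set xs. norm x = 1 \<and> G x = (x \<bullet> G x) *\<^sub>R x" "sorted_wrt (\<lambda>x y. y \<bullet> G y \<le> x \<bullet> G x) xs"
    using \<open>d = dim S'\<close> by blast
  have "orthonormal_on {..<length (x # xs)} ((!) (x # xs))"
  proof -
    have "x \<bullet> (xs ! i) = 0" if "i < length xs" for i
      using xs(2) that unfolding S'_def by (auto dest!: nth_mem)
    with xs(3) x(2) show ?thesis
      by (auto simp: orthonormal_on_def nth_Cons inner_commute norm_eq_1 split: nat.split)
  qed
  moreover have "\<forall>y\<in>set xs. y \<bullet> G y \<le> x \<bullet> G x"
    using xs(2,4) max by (auto simp: S'_def)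
  ultimately show ?case
    using xs x Suc.hyps(2) by (intro exI[of _ "x # xs"]) (auto simp: S'_def simp del: One_nat_def)
qed

section \<open>Ky Fan's inequality\<close>

text \<open>For an orthonormal \<open>g\<close> this is the orthogonal projection onto the span of
  its range; symmetry and the formula for the quadratic form hold for every family.\<close>

definition span_proj :: "('r::finite \<Rightarrow> 'a::real_inner) \<Rightarrow> 'a \<Rightarrow> 'a" where
  "span_proj g x = (\<Sum>k\<in>UNIV. (g k \<bullet> x) *\<^sub>R g k)"

lemma span_proj_symmetric: "span_proj g x \<bullet> y = x \<bullet> span_proj g y"
  by (simp add: span_proj_def inner_sum_left inner_sum_right inner_commute mult.commute)

lemma inner_span_proj: "x \<bullet> span_proj g x = (\<Sum>k\<in>UNIV. (g k \<bullet> x)\<^sup>2)"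
  by (simp add: span_proj_def inner_sum_right inner_commute power2_eq_square)

lemma span_proj_in_span: "span_proj g x \<in> span (range g)"
  unfolding span_proj_def by (intro span_sum span_scale span_base) auto

lemma span_proj_id:
  fixes g :: "'r::finite \<Rightarrow> 'a::euclidean_space"
  shows "orthonormal_on UNIV g \<Longrightarrow> x \<in> span (range g) \<Longrightarrow> span_proj g x = x"
  unfolding span_proj_def by (intro orthonormal_on_span_expand) auto

lemma span_proj_orthogonal: "(\<And>k. g k \<bullet> x = 0) \<Longrightarrow> span_proj g x = 0"
  by (simp add: span_proj_def)

text \<open>Pythagoras. For a unit vector the right-hand side is 1 minus its projection weight, so
  the weight is at most 1, with equality exactly for vectors fixed by the projection.\<close>

lemma norm_diff_span_proj:
  fixes g :: "'r::finite \<Rightarrow> 'a::euclidean_space"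
  assumes "orthonormal_on UNIV g"
  shows "(norm (x - span_proj g x))\<^sup>2 = x \<bullet> x - x \<bullet> span_proj g x"
proof -
  have "span_proj g x \<bullet> span_proj g x = x \<bullet> span_proj g x"
    by (simp add: span_proj_symmetric span_proj_id[OF assms] span_proj_in_span)
  then show ?thesis
    by (simp add: power2_norm_eq_inner inner_diff_left inner_diff_right span_proj_symmetric)
qed

text \<open>The eigenvalues form an infinite sequence continued by 0, so that they can be the same
  sequence as in \<open>eigensystem\<close> and \<open>\<tau> r\<close> exists also for
  \<open>r = DIM('a)\<close>. Members of \<open>w\<close> from index \<open>DIM('a)\<close> on are
  arbitrary.\<close>

definition sorted_eigenbasis :: "('a::euclidean_space \<Rightarrow> 'a) \<Rightarrow> (nat \<Rightarrow> real) \<Rightarrow> (nat \<Rightarrow> 'a) \<Rightarrow> bool" where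
  "sorted_eigenbasis G \<tau> w \<longleftrightarrow>
     decseq \<tau> \<and> (\<forall>j. 0 \<le> \<tau> j) \<and> (\<forall>j\<ge>DIM('a). \<tau> j = 0) \<and>
     orthonormal_on {..<DIM('a)} w \<and> (\<forall>j<DIM('a). G (w j) = \<tau> j *\<^sub>R w j)"

lemma sorted_eigenbasis_parseval:
  fixes w :: "nat \<Rightarrow> 'a::euclidean_space"
  shows "sorted_eigenbasis G \<tau> w \<Longrightarrow> (\<Sum>j<DIM('a). (w j \<bullet> x) * (w j \<bullet> y)) = x \<bullet> y"
  by (rule orthonormal_on_parseval) (simp_all add: sorted_eigenbasis_def)

lemma sorted_eigenbasis_inner:
  fixes w :: "nat \<Rightarrow> 'a::euclidean_space"
  assumes "sorted_eigenbasis G \<tau> w" and sym: "\<And>x y. G x \<bullet> y = x \<bullet> G y"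
  shows "x \<bullet> G x = (\<Sum>j<DIM('a). \<tau> j * (w j \<bullet> x)\<^sup>2)"
proof -
  have "w j \<bullet> G x = \<tau> j * (w j \<bullet> x)" if "j < DIM('a)" for j
    using assms that sym[of "w j" x] by (simp add: sorted_eigenbasis_def)
  then have "(\<Sum>j<DIM('a). (w j \<bullet> x) * (w j \<bullet> G x)) = (\<Sum>j<DIM('a). \<tau> j * (w j \<bullet> x)\<^sup>2)"
    by (intro sum.cong) (auto simp: power2_eq_square)
  then show ?thesis using sorted_eigenbasis_parseval[OF assms(1)] by metis
qed

text \<open>Both sides are the trace of \<open>span_proj g\<close> composed with \<open>G\<close>.
  Evaluation in the eigenbasis turns it into a weighted sum of eigenvalues.\<close>

lemma sorted_eigenbasis_trace:
  fixes w :: "nat \<Rightarrow> 'a::euclidean_space" and g :: "'r::finite \<Rightarrow> 'a"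
  assumes "sorted_eigenbasis G \<tau> w" and sym: "\<And>x y. G x \<bullet> y = x \<bullet> G y"
  shows "(\<Sum>k\<in>UNIV. g k \<bullet> G (g k)) = (\<Sum>j<DIM('a). \<tau> j * (w j \<bullet> span_proj g (w j)))"
proof -
  have "(\<Sum>k\<in>UNIV. g k \<bullet> G (g k)) = (\<Sum>k\<in>UNIV. \<Sum>j<DIM('a). \<tau> j * (w j \<bullet> g k)\<^sup>2)"
    by (simp add: sorted_eigenbasis_inner[OF assms])
  also have "\<dots> = (\<Sum>j<DIM('a). \<Sum>k\<in>UNIV. \<tau> j * (w j \<bullet> g k)\<^sup>2)"
    by (rule sum.swap)
  finally show ?thesis
    by (simp add: inner_span_proj sum_distrib_left inner_commute)
qed

lemma span_proj_weight_sum: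
  fixes w :: "nat \<Rightarrow> 'a::euclidean_space" and g :: "'r::finite \<Rightarrow> 'a"
  assumes "sorted_eigenbasis G \<tau> w" "orthonormal_on UNIV g"
  shows "(\<Sum>j<DIM('a). w j \<bullet> span_proj g (w j)) = real CARD('r)"
proof -
  have "(\<Sum>j<DIM('a). w j \<bullet> span_proj g (w j)) = (\<Sum>j<DIM('a). \<Sum>k\<in>UNIV. (w j \<bullet> g k) * (w j \<bullet> g k))"
    by (simp add: inner_span_proj power2_eq_square inner_commute)
  also have "\<dots> = (\<Sum>k\<in>UNIV. \<Sum>j<DIM('a). (w j \<bullet> g k) * (w j \<bullet> g k))"
    by (rule sum.swap)
  also have "\<dots> = (\<Sum>k\<in>(UNIV :: 'r set). 1)"
    using assms(2) by (simp add: sorted_eigenbasis_parseval[OF assms(1)] orthonormal_on_def)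
  finally show ?thesis by simp
qed

text \<open>The weights add up to the rank, and the \<open>r\<close> leading ones already exhaust
  it, so the remaining nonnegative weights vanish.\<close>

lemma span_proj_eq_0_of_leading:
  fixes w :: "nat \<Rightarrow> 'a::euclidean_space" and g :: "'r::finite \<Rightarrow> 'a"
  assumes basis: "sorted_eigenbasis G \<tau> w" and g: "orthonormal_on UNIV g" and r: "r = CARD('r)"
    and lead: "\<And>i. i < r \<Longrightarrow> span_proj g (w i) = w i" and j: "r \<le> j" "j < DIM('a)"
  shows "span_proj g (w j) = 0"
proof -
  have "(\<Sum>i<r. w i \<bullet> span_proj g (w i)) = (\<Sum>i<r. 1)"
    using basis lead j by (intro sum.cong) (auto simp: sorted_eigenbasis_def orthonormal_on_def)
  moreover have "(\<Sum>i<DIM('a). w i \<bullet> span_proj g (w i)) =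
      (\<Sum>i<r. w i \<bullet> span_proj g (w i)) + (\<Sum>i=r..<DIM('a). w i \<bullet> span_proj g (w i))"
    using j sum.atLeastLessThan_concat[of 0 r "DIM('a)" "\<lambda>i. w i \<bullet> span_proj g (w i)"]
    by (simp add: lessThan_atLeast0)
  ultimately have "(\<Sum>i=r..<DIM('a). w i \<bullet> span_proj g (w i)) = 0"
    using span_proj_weight_sum[OF basis g] r by simp
  then have "w j \<bullet> span_proj g (w j) = 0"
    using j by (subst (asm) sum_nonneg_eq_0_iff) (auto simp: inner_span_proj sum_nonneg)
  then have "g k \<bullet> w j = 0" for k
    by (simp add: inner_span_proj sum_nonneg_eq_0_iff)
  then show ?thesis by (rule span_proj_orthogonal)
qed

text \<open>Subtracting \<open>\<theta>\<close> times the constraint on the sum of the weights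
  leaves only differences from \<open>\<theta>\<close>. For \<open>\<theta> = \<tau> r\<close>, a
  decreasing \<open>\<tau>\<close> and weights between 0 and 1, every summand on the right is
  nonnegative.\<close>

lemma weighted_sum_defect:
  fixes \<tau> a :: "nat \<Rightarrow> real"
  assumes "(\<Sum>j<N. a j) = real r" "r \<le> N"
  shows "(\<Sum>j<r. \<tau> j) - (\<Sum>j<N. \<tau> j * a j) =
    (\<Sum>j<r. (\<tau> j - \<theta>) * (1 - a j)) + (\<Sum>j=r..<N. (\<theta> - \<tau> j) * a j)"
proof -
  have split: "(\<Sum>j<N. f j) = (\<Sum>j<r. f j) + (\<Sum>j=r..<N. f j)" for f :: "nat \<Rightarrow> real"
    using assms(2) sum.atLeastLessThan_concat[of 0 r N f] by (simp add: lessThan_atLeast0)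
  have 1: "\<theta> * real r = \<theta> * (\<Sum>j<r. a j) + \<theta> * (\<Sum>j=r..<N. a j)"
    using assms(1) split[of a] by (simp flip: distrib_left)
  have "(\<Sum>j<r. (\<tau> j - \<theta>) * (1 - a j)) =
    (\<Sum>j<r. \<tau> j) - (\<Sum>j<r. \<tau> j * a j) - \<theta> * real r + \<theta> * (\<Sum>j<r. a j)"
    by (simp add: algebra_simps sum.distrib sum_subtractf sum_distrib_left)
  moreover have "(\<Sum>j=r..<N. (\<theta> - \<tau> j) * a j) = \<theta> * (\<Sum>j=r..<N. a j) - (\<Sum>j=r..<N. \<tau> j * a j)"
    by (simp add: algebra_simps sum_subtractf sum_distrib_left)
  ultimately show ?thesis
    using 1 split[of "\<lambda>j. \<tau> j * a j"] by simp
qed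

text \<open>The defect in the bound is a sum of nonnegative terms, so equality makes each term
  vanish. An eigenvector with eigenvalue above \<open>\<tau> r\<close> then has weight 1 and one
  with eigenvalue below has weight 0; the vanishing terms put no constraint on eigenvectors for
  \<open>\<tau> r\<close> itself.\<close>

lemma ky_fan:
  fixes w :: "nat \<Rightarrow> 'a::euclidean_space" and g :: "'r::finite \<Rightarrow> 'a"
  assumes basis: "sorted_eigenbasis G \<tau> w" and sym: "\<And>x y. G x \<bullet> y = x \<bullet> G y"
    and g: "orthonormal_on UNIV g" and r: "r = CARD('r)" "r \<le> DIM('a)"
  shows ky_fan_le: "(\<Sum>k\<in>UNIV. g k \<bullet> G (g k)) \<le> (\<Sum>j<r. \<tau> j)"
    and ky_fan_eq: "(\<Sum>k\<in>UNIV. g k \<bullet> G (g k)) = (\<Sum>j<r. \<tau> j) \<Longrightarrow> j < DIM('a) \<Longrightarrow>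
      (\<tau> r < \<tau> j \<longrightarrow> span_proj g (w j) = w j) \<and> (\<tau> j < \<tau> r \<longrightarrow> span_proj g (w j) = 0) \<and>
      (j < r \<longrightarrow> \<tau> j = \<tau> r \<or> span_proj g (w j) = w j)"
proof -
  define a where "a j = w j \<bullet> span_proj g (w j)" for j
  have dec: "decseq \<tau>" using basis by (simp add: sorted_eigenbasis_def)
  have w1: "w j \<bullet> w j = 1" if "j < DIM('a)" for j
    using basis that by (simp add: sorted_eigenbasis_def orthonormal_on_def)
  have defect: "(norm (w j - span_proj g (w j)))\<^sup>2 = 1 - a j" if "j < DIM('a)" for j
    using norm_diff_span_proj[OF g, of "w j"] w1[OF that] by (simp add: a_def)
  have a1: "a j \<le> 1" if "j < DIM('a)" for j
    using defect[OF that] by (metis diff_ge_0_iff_ge zero_le_power2)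
  have a0: "a j \<ge> 0" for j
    by (simp add: a_def inner_span_proj sum_nonneg)
  have asum: "(\<Sum>j<DIM('a). a j) = real r"
    unfolding a_def r by (rule span_proj_weight_sum[OF basis g])
  have id: "(\<Sum>j<r. \<tau> j) - (\<Sum>k\<in>UNIV. g k \<bullet> G (g k)) =
    (\<Sum>j<r. (\<tau> j - \<tau> r) * (1 - a j)) + (\<Sum>j=r..<DIM('a). (\<tau> r - \<tau> j) * a j)"
    using weighted_sum_defect[OF asum r(2), of \<tau> "\<tau> r"] sorted_eigenbasis_trace[OF basis sym, of g]
    by (simp add: a_def)
  have nn1: "(\<tau> j - \<tau> r) * (1 - a j) \<ge> 0" if "j < r" for j
    using that r(2) a1[of j] decseqD[OF dec, of j r] by simp
  have nn2: "(\<tau> r - \<tau> j) * a j \<ge> 0" if "r \<le> j" for j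
    using that a0[of j] decseqD[OF dec, of r j] by simp
  have s1: "(\<Sum>j<r. (\<tau> j - \<tau> r) * (1 - a j)) \<ge> 0"
    using nn1 by (intro sum_nonneg) auto
  have s2: "(\<Sum>j=r..<DIM('a). (\<tau> r - \<tau> j) * a j) \<ge> 0"
    using nn2 by (intro sum_nonneg) auto
  show "(\<Sum>k\<in>UNIV. g k \<bullet> G (g k)) \<le> (\<Sum>j<r. \<tau> j)"
    using id s1 s2 by linarith
  assume eq: "(\<Sum>k\<in>UNIV. g k \<bullet> G (g k)) = (\<Sum>j<r. \<tau> j)" and j: "j < DIM('a)"
  have z1: "(\<Sum>j<r. (\<tau> j - \<tau> r) * (1 - a j)) = 0" and z2: "(\<Sum>j=r..<DIM('a). (\<tau> r - \<tau> j) * a j) = 0"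
    using id s1 s2 eq by linarith+
  have one: "\<tau> i = \<tau> r \<or> span_proj g (w i) = w i" if "i < r" for i
  proof -
    have "(\<tau> i - \<tau> r) * (1 - a i) = 0"
      using z1 sum_nonneg_eq_0_iff[of "{..<r}" "\<lambda>j. (\<tau> j - \<tau> r) * (1 - a j)"] nn1 that by auto
    moreover have "span_proj g (w i) = w i" if "a i = 1"
      using defect[of i] that \<open>i < r\<close> r(2) by simp
    ultimately show ?thesis by auto
  qed
  have zero: "span_proj g (w j) = 0" if "\<tau> j < \<tau> r"
  proof -
    have "r \<le> j" using that dec by (metis decseqD leI less_imp_le not_le)
    then have "(\<tau> r - \<tau> j) * a j = 0"
      using z2 sum_nonneg_eq_0_iff[of "{r..<DIM('a)}" "\<lambda>j. (\<tau> r - \<tau> j) * a j"] nn2 j by auto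
    then have "a j = 0" using that by auto
    then have "g k \<bullet> w j = 0" for k
      by (simp add: a_def inner_span_proj sum_nonneg_eq_0_iff)
    then show ?thesis by (rule span_proj_orthogonal)
  qed
  have "j < r" if "\<tau> r < \<tau> j" using that dec by (metis decseqD leI not_le)
  with one zero show "(\<tau> r < \<tau> j \<longrightarrow> span_proj g (w j) = w j) \<and> (\<tau> j < \<tau> r \<longrightarrow> span_proj g (w j) = 0) \<and>
      (j < r \<longrightarrow> \<tau> j = \<tau> r \<or> span_proj g (w j) = w j)"
    by (metis less_irrefl)
qed

section \<open>Sorted eigenbases and their adaptation to an optimal projection\<close>

lemma sorted_eigenbasis_of_list:
  fixes G :: "'a::euclidean_space \<Rightarrow> 'a"
  assumes psd: "\<And>x. 0 \<le> x \<bullet> G x" and len: "length xs = DIM('a)"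
    and on: "orthonormal_on {..<DIM('a)} ((!) xs)"
    and eig: "\<And>x. x \<in> set xs \<Longrightarrow> G x = (x \<bullet> G x) *\<^sub>R x"
    and sorted: "sorted_wrt (\<lambda>x y. y \<bullet> G y \<le> x \<bullet> G x) xs"
  shows "sorted_eigenbasis G (\<lambda>j. if j < DIM('a) then xs ! j \<bullet> G (xs ! j) else 0) ((!) xs)"
  unfolding sorted_eigenbasis_def
proof (intro conjI allI impI)
  show "decseq (\<lambda>j. if j < DIM('a) then xs ! j \<bullet> G (xs ! j) else 0)"
  proof (rule antimonoI)
    fix i j :: nat assume "i \<le> j"
    then show "(if j < DIM('a) then xs ! j \<bullet> G (xs ! j) else 0) \<le> (if i < DIM('a) then xs ! i \<bullet> G (xs ! i) else 0)"
      using sorted_wrt_nth_less[OF sorted, of i j] len psd by (cases "i = j") auto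
  qed
  fix j assume "j < DIM('a)"
  then show "G (xs ! j) = (if j < DIM('a) then xs ! j \<bullet> G (xs ! j) else 0) *\<^sub>R xs ! j"
    using eig[of "xs ! j"] len by simp
qed (use on psd in auto)

lemma sorted_eigenbasis_exists:
  fixes G :: "'a::euclidean_space \<Rightarrow> 'a"
  assumes lin: "linear G" and sym: "\<And>x y. G x \<bullet> y = x \<bullet> G y" and psd: "\<And>x. 0 \<le> x \<bullet> G x"
  shows "\<exists>\<tau> w. sorted_eigenbasis G \<tau> w"
proof -
  obtain xs :: "'a list" where "length xs = DIM('a)" "orthonormal_on {..<DIM('a)} ((!) xs)"
    "\<forall>x\<in>set xs. norm x = 1 \<and> G x = (x \<bullet> G x) *\<^sub>R x" "sorted_wrt (\<lambda>x y. y \<bullet> G y \<le> x \<bullet> G x) xs"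
    using symmetric_sorted_eigenlist[OF lin sym, of UNIV] by (auto simp: dim_UNIV)
  then show ?thesis
    using sorted_eigenbasis_of_list[OF psd, of xs] by blast
qed

text \<open>When eigenvalues tie across position \<open>r\<close>, the given basis need not be
  compatible with the projection, but equality in Ky Fan's bound makes the span of \<open>g\<close>
  and its orthogonal complement invariant under \<open>G\<close>. Diagonalizing \<open>G\<close> on
  both and concatenating gives a sorted list, because \<open>\<tau> r\<close> separates the Rayleigh
  quotients on the two subspaces.\<close>

lemma sorted_eigenbasis_adapted:
  fixes G :: "'a::euclidean_space \<Rightarrow> 'a" and g :: "'r::finite \<Rightarrow> 'a"
  assumes lin: "linear G" and sym: "\<And>x y. G x \<bullet> y = x \<bullet> G y" and psd: "\<And>x. 0 \<le> x \<bullet> G x"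
    and basis: "sorted_eigenbasis G \<tau> w" and g: "orthonormal_on UNIV g"
    and r: "r = CARD('r)" "r \<le> DIM('a)"
    and max: "(\<Sum>k\<in>UNIV. g k \<bullet> G (g k)) = (\<Sum>j<r. \<tau> j)"
  shows "\<exists>\<tau>' w'. sorted_eigenbasis G \<tau>' w' \<and>
    (\<forall>j<DIM('a). span_proj g (w' j) = (if j < r then w' j else 0))"
proof -
  define W where "W = span (range g)"
  define W' where "W' = {y \<in> UNIV. \<forall>x\<in>W. orthogonal x y}"
  have extreme: "\<tau> r < \<tau> j \<Longrightarrow> span_proj g (w j) = w j" "\<tau> j < \<tau> r \<Longrightarrow> span_proj g (w j) = 0"
    if "j < DIM('a)" for j
    using ky_fan_eq[OF basis sym g r max that] by auto
  have W: "subspace W" "dim W = r"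
    using dim_span_orthonormal_on[OF g] by (simp_all add: W_def r)
  have W': "subspace W'"
    using subspace_orthogonal_to_vectors[of W] by (simp add: W'_def)
  have dimW': "dim W' + r = DIM('a)"
    unfolding W'_def W(2)[symmetric]
    by (subst dim_subspace_orthogonal_to_vectors) (auto simp: W dim_UNIV)
  have projW: "span_proj g x = x" if "x \<in> W" for x
    using that span_proj_id[OF g] by (simp add: W_def)
  have projW': "span_proj g x = 0" if "x \<in> W'" for x
    using that by (intro span_proj_orthogonal) (auto simp: W'_def W_def orthogonal_def span_base)
  have wG: "w j \<bullet> G x = \<tau> j * (w j \<bullet> x)" if "j < DIM('a)" for j x
    using basis that sym[of "w j" x] by (simp add: sorted_eigenbasis_def)
  have sep: "x \<bullet> y = 0" if "x \<in> W" "y \<in> W'" for x y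
    using that by (auto simp: W'_def orthogonal_def)
  have wp: "w j \<bullet> span_proj g x = span_proj g (w j) \<bullet> x" for j x
    by (simp add: span_proj_symmetric)
  text \<open>Eigenvectors with eigenvalue above or below \<open>\<tau> r\<close> lie in \<open>W\<close> or \<open>W'\<close>; on the remaining
    eigenspace \<open>G\<close> is a multiple of the identity.\<close>
  have inv0: "x \<bullet> G y = 0" if "x \<in> W" "y \<in> W'" for x y
  proof -
    have "(w j \<bullet> x) * (w j \<bullet> G y) = \<tau> r * ((w j \<bullet> x) * (w j \<bullet> y))" if j: "j < DIM('a)" for j
    proof -
      consider "\<tau> r < \<tau> j" | "\<tau> j < \<tau> r" | "\<tau> j = \<tau> r" by linarith
      then show ?thesis
      proof cases
        case 1
        then have "w j \<bullet> y = 0" using extreme[OF j] wp[of j y] projW'[OF \<open>y \<in> W'\<close>] by simp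
        then show ?thesis by (simp add: wG[OF j])
      next
        case 2
        then have "w j \<bullet> x = 0" using extreme[OF j] wp[of j x] projW[OF \<open>x \<in> W\<close>] by simp
        then show ?thesis by simp
      qed (simp add: wG[OF j])
    qed
    then have "(\<Sum>j<DIM('a). (w j \<bullet> x) * (w j \<bullet> G y)) = \<tau> r * (\<Sum>j<DIM('a). (w j \<bullet> x) * (w j \<bullet> y))"
      unfolding sum_distrib_left by (intro sum.cong) auto
    then show ?thesis by (simp add: sorted_eigenbasis_parseval[OF basis] sep[OF that])
  qed
  have invW': "G y \<in> W'" if "y \<in> W'" for y
    using inv0 that by (auto simp: W'_def orthogonal_def)
  \<comment> \<open>The part of \<open>G x\<close> outside \<open>W\<close> lies in
    \<open>W'\<close>. By \<open>inv0\<close> and symmetry it is orthogonal to \<open>G x\<close>,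
    and by \<open>sep\<close> to the projection of \<open>G x\<close>, hence to itself.\<close>
  have invW: "G x \<in> W" if "x \<in> W" for x
  proof -
    have "z \<bullet> G x = z \<bullet> span_proj g (G x)" if "z \<in> W" for z
      using span_proj_symmetric[of g z "G x"] projW[OF that] by simp
    then have "G x - span_proj g (G x) \<in> W'"
      by (simp add: W'_def orthogonal_def inner_diff_right)
    then have "x \<bullet> G (G x - span_proj g (G x)) = 0" and d: "G x - span_proj g (G x) \<in> W'"
      using inv0 that by auto
    then have "G x \<bullet> (G x - span_proj g (G x)) = 0" by (simp add: sym)
    moreover have "span_proj g (G x) \<bullet> (G x - span_proj g (G x)) = 0"
      by (rule sep[OF _ d]) (simp add: W_def span_proj_in_span)
    ultimately have "(G x - span_proj g (G x)) \<bullet> (G x - span_proj g (G x)) = 0"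
      by (simp add: inner_diff_left)
    then have "G x = span_proj g (G x)" by simp
    then show ?thesis unfolding W_def by (metis span_proj_in_span)
  qed
  \<comment> \<open>A vector of \<open>W\<close> is orthogonal to every \<open>w j\<close> with
    \<open>\<tau> j < \<tau> r\<close>, since the projection fixes the one and kills the other. The
    bound on \<open>W'\<close> is dual.\<close>
  have lower: "\<tau> r \<le> x \<bullet> G x" if "x \<in> W" "norm x = 1" for x
  proof -
    have "\<tau> r * (w j \<bullet> x)\<^sup>2 \<le> \<tau> j * (w j \<bullet> x)\<^sup>2" if j: "j < DIM('a)" for j
    proof (cases "\<tau> j < \<tau> r")
      case True
      then have "w j \<bullet> x = 0" using extreme[OF j] wp[of j x] projW[OF \<open>x \<in> W\<close>] by simp
      then show ?thesis by simp
    qed (simp add: mult_right_mono)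
    then have "(\<Sum>j<DIM('a). \<tau> r * ((w j \<bullet> x) * (w j \<bullet> x))) \<le> x \<bullet> G x"
      unfolding sorted_eigenbasis_inner[OF basis sym] by (intro sum_mono) (auto simp: power2_eq_square)
    then show ?thesis
      using that by (simp add: sorted_eigenbasis_parseval[OF basis] norm_eq_1 flip: sum_distrib_left)
  qed
  have upper: "x \<bullet> G x \<le> \<tau> r" if "x \<in> W'" "norm x = 1" for x
  proof -
    have "\<tau> j * (w j \<bullet> x)\<^sup>2 \<le> \<tau> r * (w j \<bullet> x)\<^sup>2" if j: "j < DIM('a)" for j
    proof (cases "\<tau> r < \<tau> j")
      case True
      then have "w j \<bullet> x = 0" using extreme[OF j] wp[of j x] projW'[OF \<open>x \<in> W'\<close>] by simp
      then show ?thesis by simp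
    qed (simp add: mult_right_mono)
    then have "x \<bullet> G x \<le> (\<Sum>j<DIM('a). \<tau> r * ((w j \<bullet> x) * (w j \<bullet> x)))"
      unfolding sorted_eigenbasis_inner[OF basis sym] by (intro sum_mono) (auto simp: power2_eq_square)
    then show ?thesis
      using that by (simp add: sorted_eigenbasis_parseval[OF basis] norm_eq_1 flip: sum_distrib_left)
  qed
  obtain xs where xs: "length xs = r" "set xs \<subseteq> W" "orthonormal_on {..<length xs} ((!) xs)"
    "\<forall>x\<in>set xs. norm x = 1 \<and> G x = (x \<bullet> G x) *\<^sub>R x" "sorted_wrt (\<lambda>x y. y \<bullet> G y \<le> x \<bullet> G x) xs"
    using symmetric_sorted_eigenlist[OF lin sym W(1) invW] W(2) by auto
  obtain ys where ys: "length ys = dim W'" "set ys \<subseteq> W'" "orthonormal_on {..<length ys} ((!) ys)"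
    "\<forall>x\<in>set ys. norm x = 1 \<and> G x = (x \<bullet> G x) *\<^sub>R x" "sorted_wrt (\<lambda>x y. y \<bullet> G y \<le> x \<bullet> G x) ys"
    using symmetric_sorted_eigenlist[OF lin sym W' invW'] by auto
  have len: "length (xs @ ys) = DIM('a)" using xs(1) ys(1) dimW' by simp
  have inW: "xs ! i \<in> W" if "i < r" for i using xs(1,2) that by (metis nth_mem subsetD)
  have inW': "ys ! i \<in> W'" if "i < dim W'" for i using ys(1,2) that by (metis nth_mem subsetD)
  have "orthonormal_on {..<DIM('a)} ((!) (xs @ ys))"
    unfolding orthonormal_on_def
  proof (intro ballI)
    fix i j assume "i \<in> {..<DIM('a)}" "j \<in> {..<DIM('a)}"
    moreover have "xs ! i \<bullet> ys ! j = 0" "ys ! j \<bullet> xs ! i = 0" if "i < r" "j < dim W'" for i j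
      using sep[OF inW[OF that(1)] inW'[OF that(2)]] by (simp_all add: inner_commute)
    ultimately show "(xs @ ys) ! i \<bullet> (xs @ ys) ! j = (if i = j then 1 else 0)"
      using xs(1,3) ys(1,3) dimW' by (auto simp: nth_append orthonormal_on_def)
  qed
  moreover have "sorted_wrt (\<lambda>x y. y \<bullet> G y \<le> x \<bullet> G x) (xs @ ys)"
    unfolding sorted_wrt_append
  proof (intro conjI ballI)
    fix x y assume "x \<in> set xs" "y \<in> set ys"
    then show "y \<bullet> G y \<le> x \<bullet> G x"
      using lower[of x] upper[of y] xs(2,4) ys(2,4) by fastforce
  qed (use xs ys in auto)
  ultimately have "sorted_eigenbasis G (\<lambda>j. if j < DIM('a) then (xs @ ys) ! j \<bullet> G ((xs @ ys) ! j) else 0) ((!) (xs @ ys))"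
    using xs(4) ys(4) by (intro sorted_eigenbasis_of_list psd len) auto
  moreover have "span_proj g ((xs @ ys) ! j) = (if j < r then (xs @ ys) ! j else 0)" if "j < DIM('a)" for j
    using that xs(1) dimW' projW'[OF inW', of "j - r"] by (auto simp: nth_append intro: projW inW)
  ultimately show ?thesis by blast
qed

section \<open>Square-integrable functions and the Gram operator\<close>

lemma L2_measurable: "f \<in> L2 M \<Longrightarrow> f \<in> borel_measurable M"
  by (simp add: L2_def)

lemma L2_square_integrable: "f \<in> L2 M \<Longrightarrow> integrable M (\<lambda>x. (norm (f x))\<^sup>2)"
  by (simp add: L2_def)

lemma L2_bound:
  assumes "f \<in> borel_measurable M" "integrable M g" "\<And>x. (norm (f x))\<^sup>2 \<le> g x"
  shows "f \<in> L2 M"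
  unfolding L2_def
proof (intro CollectI conjI assms(1))
  show "integrable M (\<lambda>x. (norm (f x))\<^sup>2)"
    by (rule Bochner_Integration.integrable_bound[OF assms(2)])
      (use assms(1,3) in \<open>auto intro: order_trans[OF _ abs_ge_self]\<close>)
qed

lemma L2_zero: "(\<lambda>x. 0) \<in> L2 M"
  by (simp add: L2_def)

lemma L2_bounded_linear:
  assumes "bounded_linear T" "f \<in> L2 M"
  shows "(\<lambda>x. T (f x)) \<in> L2 M"
proof -
  obtain K where K: "\<And>x. norm (T x) \<le> norm x * K" "K > 0"
    using bounded_linear.pos_bounded[OF assms(1)] by blast
  have "(norm (T (f x)))\<^sup>2 \<le> K\<^sup>2 * (norm (f x))\<^sup>2" for x
    using power_mono[OF K(1)[of "f x"], of 2] by (simp add: power_mult_distrib mult.commute)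
  moreover have "(\<lambda>x. T (f x)) \<in> borel_measurable M"
    by (rule borel_measurable_continuous_on[OF linear_continuous_on[OF assms(1)] L2_measurable[OF assms(2)]])
  ultimately show ?thesis
    using L2_square_integrable[OF assms(2)] by (intro L2_bound[of _ _ "\<lambda>x. K\<^sup>2 * (norm (f x))\<^sup>2"]) auto
qed

lemma L2_scaleR: "f \<in> L2 M \<Longrightarrow> (\<lambda>x. c *\<^sub>R f x) \<in> L2 M"
  by (rule L2_bounded_linear[OF bounded_linear_scaleR_right])

lemma L2_add:
  assumes "f \<in> L2 M" "g \<in> L2 M"
  shows "(\<lambda>x. f x + g x) \<in> L2 M"
proof (rule L2_bound[of _ _ "\<lambda>x. 2 * (norm (f x))\<^sup>2 + 2 * (norm (g x))\<^sup>2"])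
  fix x
  have "(norm (f x + g x))\<^sup>2 \<le> (norm (f x) + norm (g x))\<^sup>2"
    by (intro power_mono norm_triangle_ineq) simp
  also have "\<dots> \<le> 2 * (norm (f x))\<^sup>2 + 2 * (norm (g x))\<^sup>2"
    using sum_squares_bound[of "norm (f x)" "norm (g x)"] by (simp add: power2_sum)
  finally show "(norm (f x + g x))\<^sup>2 \<le> 2 * (norm (f x))\<^sup>2 + 2 * (norm (g x))\<^sup>2" .
qed (use assms in \<open>auto simp: L2_def\<close>)

lemma L2_diff: "f \<in> L2 M \<Longrightarrow> g \<in> L2 M \<Longrightarrow> (\<lambda>x. f x - g x) \<in> L2 M"
  using L2_add[of f M "\<lambda>x. (-1) *\<^sub>R g x"] L2_scaleR[of g M "-1"] by simp

lemma L2_sum: "(\<And>i. i \<in> I \<Longrightarrow> f i \<in> L2 M) \<Longrightarrow> (\<lambda>x. \<Sum>i\<in>I. f i x) \<in> L2 M"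
  by (induction I rule: infinite_finite_induct) (auto intro: L2_zero L2_add)

lemma L2_inner_integrable:
  assumes "f \<in> L2 M" "g \<in> L2 M"
  shows "integrable M (\<lambda>x. f x \<bullet> g x)"
proof (rule Bochner_Integration.integrable_bound[of _ "\<lambda>x. (norm (f x))\<^sup>2 + (norm (g x))\<^sup>2"])
  show "AE x in M. norm (f x \<bullet> g x) \<le> norm ((norm (f x))\<^sup>2 + (norm (g x))\<^sup>2)"
  proof (rule AE_I2)
    fix x
    have "\<bar>f x \<bullet> g x\<bar> \<le> norm (f x) * norm (g x)" by (rule Cauchy_Schwarz_ineq2)
    moreover have "2 * (norm (f x) * norm (g x)) \<le> (norm (f x))\<^sup>2 + (norm (g x))\<^sup>2"
      using sum_squares_bound[of "norm (f x)" "norm (g x)"] by simp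
    moreover have "0 \<le> norm (f x) * norm (g x)" by simp
    ultimately show "norm (f x \<bullet> g x) \<le> norm ((norm (f x))\<^sup>2 + (norm (g x))\<^sup>2)"
      unfolding real_norm_def by linarith
  qed
qed (use assms in \<open>auto simp: L2_def\<close>)

lemma L2_inner_commute: "L2_inner M f g = L2_inner M g f"
  by (simp add: L2_inner_def inner_commute)

lemma L2_inner_scaleR_right: "L2_inner M f (\<lambda>x. c *\<^sub>R g x) = c * L2_inner M f g"
  by (simp add: L2_inner_def)

lemma L2_inner_scaleR_left: "L2_inner M (\<lambda>x. c *\<^sub>R f x) g = c * L2_inner M f g"
  by (simp add: L2_inner_def)

lemma L2_inner_diff_right:
  "f \<in> L2 M \<Longrightarrow> g \<in> L2 M \<Longrightarrow> h \<in> L2 M \<Longrightarrow> L2_inner M f (\<lambda>x. g x - h x) = L2_inner M f g - L2_inner M f h"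
  by (simp add: L2_inner_def inner_diff_right L2_inner_integrable)

lemma L2_inner_sum_right:
  assumes "f \<in> L2 M" "\<And>i. i \<in> I \<Longrightarrow> g i \<in> L2 M"
  shows "L2_inner M f (\<lambda>x. \<Sum>i\<in>I. c i *\<^sub>R g i x) = (\<Sum>i\<in>I. c i * L2_inner M f (g i))"
  using assms by (simp add: L2_inner_def inner_sum_right Bochner_Integration.integral_sum L2_inner_integrable)

lemma L2_inner_cong_AE:
  assumes "AE x in M. f x = f' x" "AE x in M. g x = g' x" "f \<in> L2 M" "f' \<in> L2 M" "g \<in> L2 M" "g' \<in> L2 M"
  shows "L2_inner M f g = L2_inner M f' g'"
  unfolding L2_inner_def
proof (rule integral_cong_AE)
  show "AE x in M. f x \<bullet> g x = f' x \<bullet> g' x"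
    using assms(1,2) by eventually_elim simp
qed (use assms in \<open>auto simp: L2_def\<close>)

lemma L2_inner_self_nonneg: "0 \<le> L2_inner M f f"
  by (simp add: L2_inner_def)

lemma L2_inner_self_eq_0:
  assumes "f \<in> L2 M" "L2_inner M f f = 0"
  shows "AE x in M. f x = 0"
  using assms integral_nonneg_eq_0_iff_AE[OF L2_inner_integrable[OF assms(1,1)]]
  by (simp add: L2_inner_def)

lemma L2_lincomb: "(\<And>i. i \<in> I \<Longrightarrow> f i \<in> L2 M) \<Longrightarrow> (\<lambda>x. \<Sum>i\<in>I. c i *\<^sub>R f i x) \<in> L2 M"
  by (intro L2_sum L2_scaleR)

lemma L2_orthonormal_lincomb_inner:
  assumes "finite I" "\<And>i. i \<in> I \<Longrightarrow> f i \<in> L2 M"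
    and "\<And>i j. i \<in> I \<Longrightarrow> j \<in> I \<Longrightarrow> L2_inner M (f i) (f j) = (if i = j then 1 else 0)"
  shows "L2_inner M (\<lambda>x. \<Sum>i\<in>I. c i *\<^sub>R f i x) (\<lambda>x. \<Sum>i\<in>I. d i *\<^sub>R f i x) = (\<Sum>i\<in>I. c i * d i)"
proof -
  have "L2_inner M (\<lambda>x. \<Sum>i\<in>I. c i *\<^sub>R f i x) (f j) = c j" if "j \<in> I" for j
  proof -
    have "L2_inner M (\<lambda>x. \<Sum>i\<in>I. c i *\<^sub>R f i x) (f j) = (\<Sum>i\<in>I. c i * L2_inner M (f j) (f i))"
      using assms(2) that by (subst L2_inner_commute) (rule L2_inner_sum_right)
    also have "\<dots> = (\<Sum>i\<in>I. if j = i then c i else 0)"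
      using assms(3) that by (intro sum.cong) auto
    finally show ?thesis using assms(1) that by simp
  qed
  then show ?thesis
    using assms(2) by (simp add: L2_inner_sum_right L2_lincomb mult.commute)
qed

section \<open>The Gram operator and the synthesis map\<close>

definition gram :: "'x measure \<Rightarrow> ('n::finite \<Rightarrow> 'x \<Rightarrow> 'b::euclidean_space) \<Rightarrow> real^'n \<Rightarrow> real^'n" where
  "gram M y x = (\<chi> s. (1 / real CARD('n)) * (\<Sum>t\<in>UNIV. x $ t * L2_inner M (y s) (y t)))"

text \<open>With \<open>Y\<close> the row of observations this is \<open>Y x\<close>. Up to the
  factor \<open>1 / n\<close>, \<open>gram\<close> is \<open>Y\<close> followed by its transpose,
  and the sample covariance operator is the composition in the other order; this is why they share
  their nonzero eigenvalues.\<close>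

definition synth :: "('n::finite \<Rightarrow> 'x \<Rightarrow> 'b::euclidean_space) \<Rightarrow> real^'n \<Rightarrow> 'x \<Rightarrow> 'b" where
  "synth y x u = (\<Sum>t\<in>UNIV. x $ t *\<^sub>R y t u)"

lemma linear_gram: "linear (gram M y)"
  by (rule linearI)
    (simp_all add: gram_def vec_eq_iff sum.distrib distrib_left sum_distrib_left algebra_simps)

lemma synth_L2: "(\<And>t. y t \<in> L2 M) \<Longrightarrow> synth y x \<in> L2 M"
  unfolding synth_def by (intro L2_lincomb)

lemma L2_inner_synth:
  "f \<in> L2 M \<Longrightarrow> (\<And>t. y t \<in> L2 M) \<Longrightarrow> L2_inner M f (synth y x) = (\<Sum>t\<in>UNIV. x $ t * L2_inner M f (y t))"
  unfolding synth_def by (rule L2_inner_sum_right)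

lemma L2_inner_synth_gram:
  fixes y :: "'n::finite \<Rightarrow> 'x \<Rightarrow> 'b::euclidean_space"
  assumes "\<And>t. y t \<in> L2 M"
  shows "L2_inner M (y s) (synth y x) = real CARD('n) * gram M y x $ s"
  using assms by (simp add: L2_inner_synth gram_def)

lemma L2_inner_synth_synth:
  fixes y :: "'n::finite \<Rightarrow> 'x \<Rightarrow> 'b::euclidean_space"
  assumes "\<And>t. y t \<in> L2 M"
  shows "L2_inner M (synth y x) (synth y z) = real CARD('n) * (x \<bullet> gram M y z)"
proof -
  have "L2_inner M (synth y x) (synth y z) = (\<Sum>t\<in>UNIV. x $ t * L2_inner M (y t) (synth y z))"
    unfolding L2_inner_commute[of M "synth y x"] L2_inner_commute[of M "y _" "synth y z"]
    using assms by (intro L2_inner_synth synth_L2)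
  then show ?thesis
    by (simp only: L2_inner_synth_gram[where y = y, OF assms]) (simp add: inner_vec_def sum_distrib_left mult.left_commute)
qed

lemma gram_symmetric:
  assumes "\<And>t. y t \<in> L2 M"
  shows "gram M y x \<bullet> z = x \<bullet> gram M y z"
  using L2_inner_synth_synth[of y M x z] L2_inner_synth_synth[of y M z x] assms
    L2_inner_commute[of M "synth y x" "synth y z"] by (simp add: inner_commute)

lemma gram_nonneg:
  fixes y :: "'n::finite \<Rightarrow> 'x \<Rightarrow> 'b::euclidean_space"
  assumes "\<And>t. y t \<in> L2 M"
  shows "0 \<le> x \<bullet> gram M y x"
  using L2_inner_self_nonneg[of M "synth y x"]
  by (simp add: L2_inner_synth_synth[where y = y, OF assms] zero_le_mult_iff)

section \<open>The integral operator of the sample covariance\<close>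

lemma integral_op_sample_cov:
  fixes y :: "'n::finite \<Rightarrow> real \<Rightarrow> real^'p::finite"
  assumes "\<And>t. y t \<in> L2 M" "f \<in> L2 M"
  shows "integral_op M (sample_cov y) f u =
    (1 / real CARD('n)) *\<^sub>R (\<Sum>t\<in>UNIV. L2_inner M (y t) f *\<^sub>R y t u)"
proof -
  have outer: "outer x z *v w = (z \<bullet> w) *\<^sub>R x" for x z w :: "real^'p"
    by (simp add: outer_def matrix_vector_mult_def vec_eq_iff inner_vec_def sum_distrib_left mult_ac)
  \<comment> \<open>Each summand of the kernel has rank one, so the integrand splits into scalar
    functions of \<open>v\<close> times vectors that depend on \<open>u\<close> alone.\<close>
  have "sample_cov y (u, v) *v f v = (\<Sum>t\<in>UNIV. (y t v \<bullet> f v) *\<^sub>R ((1 / real CARD('n)) *\<^sub>R y t u))" for v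
  proof -
    have "(\<Sum>t\<in>A. outer (y t u) (y t v)) *v f v = (\<Sum>t\<in>A. (y t v \<bullet> f v) *\<^sub>R y t u)" for A
      by (induction A rule: infinite_finite_induct)
        (simp_all add: matrix_vector_mult_add_rdistrib outer)
    then show ?thesis
      unfolding sample_cov_def prod.case scaleR_matrix_vector_assoc[symmetric]
      by (simp add: scaleR_sum_right)
  qed
  then have "integral_op M (sample_cov y) f u =
      (\<Sum>t\<in>UNIV. \<integral>v. (y t v \<bullet> f v) *\<^sub>R ((1 / real CARD('n)) *\<^sub>R y t u) \<partial>M)"
    unfolding integral_op_def using assms by (simp add: Bochner_Integration.integral_sum L2_inner_integrable)
  then show ?thesis
    using assms by (simp add: L2_inner_integrable L2_inner_def scaleR_sum_right mult.commute)
qed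

lemma L2_inner_integral_op:
  fixes y :: "'n::finite \<Rightarrow> real \<Rightarrow> real^'p::finite"
  assumes "\<And>t. y t \<in> L2 M" "f \<in> L2 M" "g \<in> L2 M"
  shows "L2_inner M g (integral_op M (sample_cov y) f) =
    (1 / real CARD('n)) * (\<Sum>t\<in>UNIV. L2_inner M (y t) f * L2_inner M (y t) g)"
proof -
  have "integral_op M (sample_cov y) f = (\<lambda>u. (1 / real CARD('n)) *\<^sub>R (\<Sum>t\<in>UNIV. L2_inner M (y t) f *\<^sub>R y t u))"
    by (rule ext) (rule integral_op_sample_cov[OF assms(1,2)])
  then show ?thesis
    using assms(1,3) by (simp add: L2_inner_scaleR_right L2_inner_sum_right)
      (simp add: L2_inner_commute)
qed

lemma integral_op_L2:
  fixes y :: "'n::finite \<Rightarrow> real \<Rightarrow> real^'p::finite"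
  assumes "\<And>t. y t \<in> L2 M" "f \<in> L2 M"
  shows "integral_op M (sample_cov y) f \<in> L2 M"
proof -
  have "integral_op M (sample_cov y) f = (\<lambda>u. (1 / real CARD('n)) *\<^sub>R (\<Sum>t\<in>UNIV. L2_inner M (y t) f *\<^sub>R y t u))"
    by (rule ext) (rule integral_op_sample_cov[OF assms])
  then show ?thesis using assms by (simp only:) (intro L2_scaleR L2_lincomb)
qed

section \<open>Eigenfunctions of the sample covariance and eigenvectors of the Gram operator\<close>

lemma eigensystem_loadings:
  fixes y :: "'n::finite \<Rightarrow> real \<Rightarrow> real^'p::finite"
  assumes y: "\<And>t. y t \<in> L2 M" and es: "eigensystem M (sample_cov y) \<tau> \<phi>"
  shows "(\<chi> t. L2_inner M (y t) (\<phi> i)) \<bullet> (\<chi> t. L2_inner M (y t) (\<phi> j)) =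
    (if i = j then real CARD('n) * \<tau> j else 0)"
proof -
  have phi: "\<phi> k \<in> L2 M" for k using es by (simp add: eigensystem_def)
  have "AE u in M. integral_op M (sample_cov y) (\<phi> j) u = \<tau> j *\<^sub>R \<phi> j u"
    using es by (simp add: eigensystem_def)
  \<comment> \<open>By \<open>L2_inner_integral_op\<close> the left side is \<open>1 / n\<close>
    times the inner product of the two loading vectors; the eigenvalue equation evaluates it as
    \<open>\<tau> j\<close> times the inner product of the eigenfunctions.\<close>
  then have "L2_inner M (\<phi> i) (integral_op M (sample_cov y) (\<phi> j)) = L2_inner M (\<phi> i) (\<lambda>u. \<tau> j *\<^sub>R \<phi> j u)"
    using phi y by (intro L2_inner_cong_AE) (auto intro: L2_scaleR integral_op_L2)
  then show ?thesis
    using es unfolding L2_inner_integral_op[OF y phi phi]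
    by (simp add: eigensystem_def L2_inner_scaleR_right inner_vec_def field_simps)
qed

text \<open>Loading vectors are orthogonal, and nonzero wherever the eigenvalue is positive. Since
  \<open>\<tau>\<close> decreases, a positive \<open>\<tau> j\<close> would produce
  \<open>j + 1 > CARD('n)\<close> of them in \<open>real^'n\<close>.\<close>

lemma eigensystem_rank:
  fixes y :: "'n::finite \<Rightarrow> real \<Rightarrow> real^'p::finite"
  assumes y: "\<And>t. y t \<in> L2 M" and es: "eigensystem M (sample_cov y) \<tau> \<phi>" and j: "CARD('n) \<le> j"
  shows "\<tau> j = 0"
proof (rule ccontr)
  assume "\<tau> j \<noteq> 0"
  have "decseq \<tau>" "0 \<le> \<tau> j" using es by (auto simp: eigensystem_def)
  with \<open>\<tau> j \<noteq> 0\<close> have pos: "0 < \<tau> i" if "i \<le> j" for i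
    using decseqD[of \<tau> i j] that by linarith
  have "card {..j} \<le> DIM(real^'n)"
  proof (rule card_orthogonal_nonzero_le)
    fix i assume "i \<in> {..j}"
    then have "(\<chi> t. L2_inner M (y t) (\<phi> i)) \<bullet> (\<chi> t. L2_inner M (y t) (\<phi> i)) \<noteq> 0"
      using pos[of i] by (simp add: eigensystem_loadings[OF y es])
    then show "(\<chi> t. L2_inner M (y t) (\<phi> i)) \<noteq> 0" by (metis inner_zero_left)
  qed (simp_all add: eigensystem_loadings[OF y es])
  then show False using j by simp
qed

text \<open>The remainder \<open>f\<close> of the expansion is orthogonal to all eigenfunctions, so
  completeness puts it in the kernel of the integral operator. The quadratic form of that operator
  at \<open>f\<close> is the mean of the squared inner products with the observations, so
  \<open>f\<close> is orthogonal to the observations as well and finally to itself.\<close>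

lemma eigensystem_expansion:
  fixes y :: "'n::finite \<Rightarrow> real \<Rightarrow> real^'p::finite"
  assumes y: "\<And>t. y t \<in> L2 M" and es: "eigensystem M (sample_cov y) \<tau> \<phi>"
  shows "AE u in M. y t u = (\<Sum>j<CARD('n). L2_inner M (y t) (\<phi> j) *\<^sub>R \<phi> j u)"
proof -
  define f where "f u = y t u - (\<Sum>j<CARD('n). L2_inner M (y t) (\<phi> j) *\<^sub>R \<phi> j u)" for u
  have phi: "\<phi> k \<in> L2 M" for k using es by (simp add: eigensystem_def)
  have on: "L2_inner M (\<phi> i) (\<phi> j) = (if i = j then 1 else 0)" for i j
    using es by (simp add: eigensystem_def)
  have S: "(\<lambda>u. \<Sum>j<CARD('n). L2_inner M (y t) (\<phi> j) *\<^sub>R \<phi> j u) \<in> L2 M"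
    by (intro L2_lincomb phi)
  have f: "f \<in> L2 M" unfolding f_def by (intro L2_diff y S)
  have orth: "L2_inner M (\<phi> k) f = 0" for k
  proof -
    have "L2_inner M (\<phi> k) f = L2_inner M (\<phi> k) (y t) - (\<Sum>j<CARD('n). L2_inner M (y t) (\<phi> j) * L2_inner M (\<phi> k) (\<phi> j))"
      unfolding f_def by (simp add: L2_inner_diff_right phi y S L2_inner_sum_right)
    also have "\<dots> = (if k < CARD('n) then 0 else L2_inner M (y t) (\<phi> k))"
      by (simp add: on L2_inner_commute[of M "\<phi> k" "y t"] if_distrib cong: if_cong)
    also have "\<dots> = 0"
    proof (cases "k < CARD('n)")
      case False
      then have "\<tau> k = 0" using eigensystem_rank[OF y es] by simp
      then have "(\<chi> t. L2_inner M (y t) (\<phi> k)) = 0"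
        using eigensystem_loadings[OF y es, of k k] by simp
      then show ?thesis by (simp add: vec_eq_iff)
    qed simp
    finally show ?thesis .
  qed
  have orth': "L2_inner M f (\<phi> k) = 0" for k
    using orth[of k] L2_inner_commute[of M f "\<phi> k"] by simp
  have "AE u in M. integral_op M (sample_cov y) f u = 0"
    using es f orth' by (auto simp: eigensystem_def)
  then have "L2_inner M f (integral_op M (sample_cov y) f) = L2_inner M f (\<lambda>u. 0)"
    using f y by (intro L2_inner_cong_AE) (auto intro: L2_zero integral_op_L2)
  then have "(\<Sum>s\<in>UNIV. L2_inner M (y s) f * L2_inner M (y s) f) = 0"
    unfolding L2_inner_integral_op[OF y f f] by (simp add: L2_inner_def)
  then have yf: "L2_inner M (y t) f = 0"
    by (simp add: sum_nonneg_eq_0_iff)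
  have "L2_inner M f f = L2_inner M f (y t) - (\<Sum>j<CARD('n). L2_inner M (y t) (\<phi> j) * L2_inner M f (\<phi> j))"
  proof -
    have "L2_inner M f f = L2_inner M f (\<lambda>u. y t u - (\<Sum>j<CARD('n). L2_inner M (y t) (\<phi> j) *\<^sub>R \<phi> j u))"
      by (simp add: f_def[abs_def])
    then show ?thesis by (simp add: L2_inner_diff_right f y S L2_inner_sum_right phi)
  qed
  also have "\<dots> = 0" using yf orth' L2_inner_commute[of M f "y t"] by simp
  finally have "AE u in M. f u = 0" by (rule L2_inner_self_eq_0[OF f])
  then show ?thesis by (simp add: f_def)
qed

text \<open>For a positive eigenvalue \<open>w j\<close> is the normalized loading vector; an
  orthonormal extension fills the other positions, where both sides of the link are 0. Parseval for
  the expansions writes the Gram operator as a sum over loading vectors, from which the eigenvalue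
  equation follows.\<close>

lemma eigensystem_gram_eigenbasis:
  fixes y :: "'n::finite \<Rightarrow> real \<Rightarrow> real^'p::finite"
  assumes y: "\<And>t. y t \<in> L2 M" and es: "eigensystem M (sample_cov y) \<tau> \<phi>"
  shows "\<exists>w. sorted_eigenbasis (gram M y) \<tau> w \<and>
    (\<forall>j<CARD('n). \<forall>t. L2_inner M (y t) (\<phi> j) = sqrt (real CARD('n) * \<tau> j) * w j $ t)"
proof -
  define v where "v j = (\<chi> t. L2_inner M (y t) (\<phi> j))" for j
  have vv: "v i \<bullet> v j = (if i = j then real CARD('n) * \<tau> j else 0)" for i j
    unfolding v_def by (rule eigensystem_loadings[OF y es])
  have phi: "\<phi> k \<in> L2 M" for k using es by (simp add: eigensystem_def)
  have on: "L2_inner M (\<phi> i) (\<phi> j) = (if i = j then 1 else 0)" for i j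
    using es by (simp add: eigensystem_def)
  have tau: "0 \<le> \<tau> j" for j using es by (simp add: eigensystem_def)
  have inner: "L2_inner M (y s) (y t) = (\<Sum>j<CARD('n). v j $ s * v j $ t)" for s t
  proof -
    have "L2_inner M (y s) (y t) = L2_inner M (\<lambda>u. \<Sum>j<CARD('n). L2_inner M (y s) (\<phi> j) *\<^sub>R \<phi> j u)
        (\<lambda>u. \<Sum>j<CARD('n). L2_inner M (y t) (\<phi> j) *\<^sub>R \<phi> j u)"
      by (intro L2_inner_cong_AE eigensystem_expansion[OF y es] y L2_lincomb phi)
    then show ?thesis by (simp add: L2_orthonormal_lincomb_inner phi on v_def)
  qed
  have gram: "gram M y x = (1 / real CARD('n)) *\<^sub>R (\<Sum>j<CARD('n). (v j \<bullet> x) *\<^sub>R v j)" for x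
  proof -
    have "(\<Sum>t\<in>UNIV. x $ t * L2_inner M (y s) (y t)) = (\<Sum>j<CARD('n). (v j \<bullet> x) * v j $ s)" for s
    proof -
      have "(\<Sum>t\<in>UNIV. x $ t * L2_inner M (y s) (y t)) = (\<Sum>t\<in>UNIV. \<Sum>j<CARD('n). x $ t * (v j $ s * v j $ t))"
        by (simp add: inner sum_distrib_left)
      also have "\<dots> = (\<Sum>j<CARD('n). \<Sum>t\<in>UNIV. x $ t * (v j $ s * v j $ t))" by (rule sum.swap)
      finally show ?thesis by (simp add: inner_vec_def sum_distrib_left sum_distrib_right mult_ac)
    qed
    then show ?thesis by (simp add: gram_def vec_eq_iff)
  qed
  define I where "I = {j. j < CARD('n) \<and> 0 < \<tau> j}"
  define K where "K = {j. j < CARD('n) \<and> \<tau> j = 0}"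
  have IK: "I \<union> K = {..<CARD('n)}" "finite I" "finite K" "I \<inter> K = {}"
    using tau by (auto simp: I_def K_def) (metis order_le_less)
  have on_I: "orthonormal_on I (\<lambda>j. (1 / sqrt (real CARD('n) * \<tau> j)) *\<^sub>R v j)"
    by (auto simp: orthonormal_on_def I_def vv)
  obtain w where w: "orthonormal_on {..<CARD('n)} w"
    and wI: "\<And>j. j \<in> I \<Longrightarrow> w j = (1 / sqrt (real CARD('n) * \<tau> j)) *\<^sub>R v j"
    using orthonormal_on_extend[OF IK(2) on_I IK(3,4)] by (auto simp: IK(1))
  have v0: "v j = 0" if "\<tau> j = 0" for j using vv[of j j] that by simp
  have link: "v j = sqrt (real CARD('n) * \<tau> j) *\<^sub>R w j" if "j < CARD('n)" for j
    using wI[of j] v0[of j] that tau[of j] by (cases "\<tau> j = 0") (auto simp: I_def)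
  have "gram M y (w j) = \<tau> j *\<^sub>R w j" if j: "j < CARD('n)" for j
  proof -
    have "(\<Sum>i<CARD('n). (v i \<bullet> w j) *\<^sub>R v i) =
        (\<Sum>i<CARD('n). if i = j then (real CARD('n) * \<tau> j) *\<^sub>R w j else 0)"
    proof (intro sum.cong refl)
      fix i assume "i \<in> {..<CARD('n)}"
      then show "(v i \<bullet> w j) *\<^sub>R v i = (if i = j then (real CARD('n) * \<tau> j) *\<^sub>R w j else 0)"
        using w j tau[of j] by (auto simp: link orthonormal_on_def)
    qed
    then show ?thesis using j by (simp add: gram)
  qed
  then have "sorted_eigenbasis (gram M y) \<tau> w"
    using es w eigensystem_rank[OF y es] by (auto simp: sorted_eigenbasis_def eigensystem_def)
  moreover have "L2_inner M (y t) (\<phi> j) = sqrt (real CARD('n) * \<tau> j) * w j $ t" if "j < CARD('n)" for j t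
    using link[OF that] by (simp add: v_def vec_eq_iff)
  ultimately show ?thesis by blast
qed

text \<open>The converse passage: where \<open>\<tau> j\<close> is positive, \<open>\<phi> j\<close>
  is the normalized synthesis of \<open>w j\<close>. The infinitely many positions with eigenvalue 0
  are filled by the \<open>e j\<close>, which the integral operator annihilates because they are
  orthogonal to all observations.\<close>

lemma gram_eigenbasis_eigensystem:
  fixes y :: "'n::finite \<Rightarrow> real \<Rightarrow> real^'p::finite" and e :: "nat \<Rightarrow> real \<Rightarrow> real^'p"
  assumes y: "\<And>t. y t \<in> L2 M" and basis: "sorted_eigenbasis (gram M y) \<tau> w"
    and e: "\<And>k. e k \<in> L2 M" "\<And>i j. L2_inner M (e i) (e j) = (if i = j then 1 else 0)"
      "\<And>k t. L2_inner M (y t) (e k) = 0"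
  shows "\<exists>\<phi>. eigensystem M (sample_cov y) \<tau> \<phi> \<and>
    (\<forall>j<CARD('n). \<forall>t. L2_inner M (y t) (\<phi> j) = sqrt (real CARD('n) * \<tau> j) * w j $ t)"
proof -
  define \<phi> where "\<phi> j = (if 0 < \<tau> j then (\<lambda>u. (1 / sqrt (real CARD('n) * \<tau> j)) *\<^sub>R synth y (w j) u) else e j)" for j
  have tau: "0 \<le> \<tau> j" "decseq \<tau>" and tau0: "CARD('n) \<le> j \<Longrightarrow> \<tau> j = 0" for j
    using basis by (simp_all add: sorted_eigenbasis_def)
  have small: "j < CARD('n)" if "0 < \<tau> j" for j using tau0[of j] that by linarith
  have phi: "\<phi> j \<in> L2 M" for j
  proof (cases "0 < \<tau> j")
    case True
    show ?thesis unfolding \<phi>_def if_P[OF True] by (intro L2_scaleR synth_L2 y)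
  qed (simp add: \<phi>_def e(1))
  have eig: "gram M y (w j) = \<tau> j *\<^sub>R w j" if "j < CARD('n)" for j
    using basis that by (simp add: sorted_eigenbasis_def)
  have ww: "w i \<bullet> w j = (if i = j then 1 else 0)" if "i < CARD('n)" "j < CARD('n)" for i j
    using basis that by (simp add: sorted_eigenbasis_def orthonormal_on_def)
  have link: "L2_inner M (y t) (\<phi> j) = (if 0 < \<tau> j then sqrt (real CARD('n) * \<tau> j) * w j $ t else 0)" for j t
    using small[of j]
    by (simp add: \<phi>_def e(3) L2_inner_scaleR_right L2_inner_synth_gram[where y = y, OF y] eig real_div_sqrt
        flip: mult.assoc)
  have "L2_inner M (e k) (y t) = 0" for k t
    using e(3)[of t k] L2_inner_commute[of M "e k" "y t"] by simp
  then have synth_e: "L2_inner M (e k) (synth y x) = 0" "L2_inner M (synth y x) (e k) = 0" for k x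
    using L2_inner_commute[of M "synth y x" "e k"] by (simp_all add: L2_inner_synth e(1) y)
  have on: "L2_inner M (\<phi> i) (\<phi> j) = (if i = j then 1 else 0)" for i j
  proof -
    consider "0 < \<tau> i" "0 < \<tau> j" | "0 < \<tau> i" "\<not> 0 < \<tau> j" | "\<not> 0 < \<tau> i" by blast
    then show ?thesis
    proof cases
      case 1
      have "L2_inner M (\<phi> i) (\<phi> j) = (1 / sqrt (real CARD('n) * \<tau> i)) * (1 / sqrt (real CARD('n) * \<tau> j)) *
          (real CARD('n) * (w i \<bullet> gram M y (w j)))"
        using 1 by (simp add: \<phi>_def L2_inner_scaleR_right L2_inner_scaleR_left L2_inner_synth_synth[where y = y, OF y])
      then show ?thesis
        using 1 small by (simp add: eig ww)
    next
      case 2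
      then show ?thesis
        by (auto simp: \<phi>_def L2_inner_scaleR_left synth_e)
    next
      case 3
      then show ?thesis
        by (auto simp: \<phi>_def e(2) L2_inner_scaleR_right synth_e)
    qed
  qed
  have op: "integral_op M (sample_cov y) (\<phi> j) u = \<tau> j *\<^sub>R \<phi> j u" for j u
  proof (cases "0 < \<tau> j")
    case True
    then have "(1 / real CARD('n)) *\<^sub>R (\<Sum>t\<in>UNIV. L2_inner M (y t) (\<phi> j) *\<^sub>R y t u) =
        (sqrt (real CARD('n) * \<tau> j) / real CARD('n)) *\<^sub>R synth y (w j) u"
      by (simp add: link synth_def scaleR_sum_right)
    also have "sqrt (real CARD('n) * \<tau> j) / real CARD('n) = \<tau> j * (1 / sqrt (real CARD('n) * \<tau> j))"
      using True by (simp add: field_simps)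
    finally show ?thesis
      using True unfolding integral_op_sample_cov[OF y phi] by (simp add: \<phi>_def)
  next
    case False
    then have "\<tau> j = 0" using tau(1)[of j] by simp
    then show ?thesis by (simp add: integral_op_sample_cov[OF y phi] link)
  qed
  have complete: "integral_op M (sample_cov y) f u = 0" if f: "f \<in> L2 M" "\<forall>j. L2_inner M f (\<phi> j) = 0" for f u
  proof -
    \<comment> \<open>Orthogonality to \<open>\<phi> j\<close> gives this directly for a positive
      eigenvalue. For eigenvalue 0 the synthesis has squared norm \<open>n * \<tau> j = 0\<close>
      and is null. As the \<open>w j\<close> span \<open>real^'n\<close>, \<open>f\<close> is then
      orthogonal to every observation.\<close>
    have Y0: "L2_inner M f (synth y (w j)) = 0" if j: "j < CARD('n)" for j
    proof (cases "0 < \<tau> j")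
      case True
      then show ?thesis using f(2)[rule_format, of j] by (simp add: \<phi>_def L2_inner_scaleR_right)
    next
      case False
      then have "L2_inner M (synth y (w j)) (synth y (w j)) = 0"
        using tau(1)[of j] j by (simp add: L2_inner_synth_synth[where y = y, OF y] eig)
      then have "AE u in M. synth y (w j) u = 0"
        by (intro L2_inner_self_eq_0 synth_L2 y)
      then have "L2_inner M f (synth y (w j)) = L2_inner M f (\<lambda>u. 0)"
        by (intro L2_inner_cong_AE f synth_L2 y L2_zero) auto
      then show ?thesis by (simp add: L2_inner_def)
    qed
    have "L2_inner M (y t) f = 0" for t
    proof -
      have "(\<Sum>j<DIM(real^'n). (w j \<bullet> (\<chi> s. L2_inner M f (y s))) * (w j \<bullet> axis t 1)) = (\<chi> s. L2_inner M f (y s)) \<bullet> axis t 1"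
        by (rule sorted_eigenbasis_parseval[OF basis])
      moreover have "w j \<bullet> (\<chi> s. L2_inner M f (y s)) = 0" if "j < CARD('n)" for j
        using Y0[OF that] by (simp add: L2_inner_synth[OF f(1) y] inner_vec_def)
      ultimately show ?thesis using L2_inner_commute[of M f "y t"] by (simp add: inner_axis)
    qed
    then show ?thesis by (simp add: integral_op_sample_cov[OF y f(1)])
  qed
  have "eigensystem M (sample_cov y) \<tau> \<phi>"
    unfolding eigensystem_def using tau phi on op complete by auto
  moreover have "L2_inner M (y t) (\<phi> j) = sqrt (real CARD('n) * \<tau> j) * w j $ t" for j t
    using tau(1)[of j] by (simp add: link)
  ultimately show ?thesis by blast
qed

section \<open>Orthonormal sequences and square-integrable kernels\<close>

text \<open>Normalized indicators of disjoint intervals of positive length form such a sequence. It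
  makes room for the infinitely many eigenfunctions with eigenvalue 0.\<close>

lemma L2_orthonormal_sequence_lebesgue_on:
  fixes a b :: real
  assumes "a < b"
  obtains h :: "nat \<Rightarrow> real \<Rightarrow> 'b::euclidean_space"
  where "\<And>k. h k \<in> L2 (lebesgue_on {a..b})"
    "\<And>i j. L2_inner (lebesgue_on {a..b}) (h i) (h j) = (if i = j then 1 else 0)"
proof -
  let ?M = "lebesgue_on {a..b}"
  obtain c :: 'b where "c \<in> Basis" using nonempty_Basis by blast
  then have c: "c \<bullet> c = 1" by simp
  \<comment> \<open>The points start at \<open>p 0 = b\<close> and decrease strictly towards
    \<open>a\<close>; the half-open intervals between neighbours are disjoint.\<close>
  define p where "p k = a + (b - a) / (real k + 1)" for k
  define D where "D k = {p (Suc k) <.. p k}" for k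
  have p_anti: "p j \<le> p i" if "i \<le> j" for i j
    using that assms unfolding p_def by (intro add_left_mono divide_left_mono mult_pos_pos) auto
  have p_less: "p (Suc k) < p k" for k
    using assms unfolding p_def by (intro add_strict_left_mono divide_strict_left_mono mult_pos_pos) auto
  have D_sub: "D k \<subseteq> {a..b}" for k
  proof -
    have "a \<le> p (Suc k)" "p k \<le> b"
      using assms p_anti[of 0 k] by (auto simp: p_def)
    then show ?thesis by (auto simp: D_def)
  qed
  have disj: "D i \<inter> D j = {}" if "i < j" for i j
    using p_anti[of "Suc i" j] that by (auto simp: D_def)
  have D_meas: "D k \<in> sets ?M" for k
    using D_sub[of k] by (auto simp: sets_restrict_space D_def intro!: image_eqI[of _ _ "{p (Suc k) <.. p k}"])
  have D_measure: "measure ?M (D k) = p k - p (Suc k)" for k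
    using D_sub[of k] p_less[of k] by (subst measure_restrict_space) (auto simp: D_def)
  have D_int: "(\<integral>x. indicator (D k) x \<partial>?M) = p k - p (Suc k)" for k
    using D_meas[of k] D_sub[of k] D_measure[of k] by (simp add: inf.absorb1)
  define h where "h k u = (indicator (D k) u / sqrt (p k - p (Suc k))) *\<^sub>R c" for k u
  have h: "h k \<in> L2 ?M" for k
  proof (rule L2_bound[of _ _ "\<lambda>_. 1 / (p k - p (Suc k))"])
    show "h k \<in> borel_measurable ?M"
      unfolding h_def using D_meas[of k] by measurable
    show "integrable ?M (\<lambda>_. 1 / (p k - p (Suc k)))" by simp
    show "(norm (h k x))\<^sup>2 \<le> 1 / (p k - p (Suc k))" for x
      using p_less[of k] c by (auto simp: h_def power_divide power_mult_distrib norm_eq_1[symmetric] indicator_def)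
  qed
  moreover have "L2_inner ?M (h i) (h j) = (if i = j then 1 else 0)" for i j
  proof (cases "i = j")
    case True
    have "h i u \<bullet> h i u = indicator (D i) u * (1 / (p i - p (Suc i)))" for u
      using p_less[of i] by (auto simp: h_def c indicator_def)
    then show ?thesis
      using True p_less[of i] unfolding L2_inner_def by (simp add: D_int del: Bochner_Integration.integral_indicator)
  next
    case False
    have "h i u \<bullet> h j u = 0" for u
      using disj[of i j] disj[of j i] False by (cases "i < j") (auto simp: h_def indicator_def)
    then show ?thesis using False by (simp add: L2_inner_def)
  qed
  ultimately show ?thesis using that by blast
qed

text \<open>Each \<open>e k\<close> is a combination of \<open>CARD('n) + 1\<close> members of the given sequence, since
  \<open>CARD('n)\<close> linear conditions cannot exclude all such combinations; distinct \<open>k\<close> use disjoint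
  sets of members.\<close>
lemma L2_orthonormal_sequence_orthogonal_to:
  fixes y :: "'n::finite \<Rightarrow> 'x \<Rightarrow> 'b::euclidean_space" and h :: "nat \<Rightarrow> 'x \<Rightarrow> 'b"
  assumes y: "\<And>t. y t \<in> L2 M" and h: "\<And>k. h k \<in> L2 M"
    and on: "\<And>i j. L2_inner M (h i) (h j) = (if i = j then 1 else 0)"
  obtains e :: "nat \<Rightarrow> 'x \<Rightarrow> 'b" where "\<And>k. e k \<in> L2 M"
    "\<And>i j. L2_inner M (e i) (e j) = (if i = j then 1 else 0)" "\<And>k t. L2_inner M (y t) (e k) = 0"
proof -
  obtain f :: "'n option \<Rightarrow> nat" where f: "inj f"
    using finite_imp_inj_to_nat_seg[OF finite, of "UNIV :: 'n option set"] by auto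
  define ix where "ix k i = prod_encode (k, f i)" for k i
  have ix: "ix k i = ix l j \<longleftrightarrow> k = l \<and> i = j" for k l i j
    using f by (auto simp: ix_def prod_encode_eq inj_eq)
  have "\<exists>x :: real^('n option). norm x = 1 \<and> (\<forall>t. (\<Sum>i\<in>UNIV. x $ i * L2_inner M (y t) (h (ix k i))) = 0)" for k
  proof -
    define A :: "real^('n option)^'n" where "A = (\<chi> t i. L2_inner M (y t) (h (ix k i)))"
    have "rank A \<le> CARD('n)" using rank_bound[of A] by simp
    then have "rank A \<noteq> CARD('n option)" by (simp add: card_option)
    then obtain x where x: "x \<noteq> 0" "A *v x = 0"
      using matrix_nonfull_linear_equations_eq[of A] by blast
    then have "A *v (x /\<^sub>R norm x) = 0" by (simp add: matrix_vector_mult_scaleR)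
    then have "\<forall>t. (\<Sum>i\<in>UNIV. (x /\<^sub>R norm x) $ i * L2_inner M (y t) (h (ix k i))) = 0"
      by (simp add: A_def matrix_vector_mult_def vec_eq_iff mult.commute)
    moreover have "norm (x /\<^sub>R norm x) = 1" using x(1) by simp
    ultimately show ?thesis by blast
  qed
  then obtain x :: "nat \<Rightarrow> real^('n option)" where x: "\<And>k. norm (x k) = 1"
    and orth: "\<And>k t. (\<Sum>i\<in>UNIV. x k $ i * L2_inner M (y t) (h (ix k i))) = 0"
    by metis
  define e where "e k u = (\<Sum>i\<in>UNIV. x k $ i *\<^sub>R h (ix k i) u)" for k u
  have e: "e k \<in> L2 M" for k unfolding e_def by (intro L2_lincomb h)
  have right: "g \<in> L2 M \<Longrightarrow> L2_inner M g (e k) = (\<Sum>i\<in>UNIV. x k $ i * L2_inner M g (h (ix k i)))" for g k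
    unfolding e_def by (rule L2_inner_sum_right) (simp_all add: h)
  have "L2_inner M (e k) (e l) = (if k = l then 1 else 0)" for k l
  proof -
    have he: "L2_inner M (e k) (h (ix l i)) = (if k = l then x k $ i else 0)" for i
    proof -
      have "L2_inner M (e k) (h (ix l i)) = (\<Sum>j\<in>UNIV. x k $ j * L2_inner M (h (ix l i)) (h (ix k j)))"
        using right[OF h] by (simp add: L2_inner_commute[of M "e k"])
      also have "\<dots> = (\<Sum>j\<in>UNIV. if j = i then (if k = l then x k $ i else 0) else 0)"
        by (intro sum.cong) (auto simp: on ix)
      finally show ?thesis by simp
    qed
    show ?thesis
      using x[of k] by (auto simp: right[OF e] he norm_eq_1 inner_vec_def)
  qed
  then show ?thesis using that[of e] e right[OF y] orth by simp
qed

section \<open>Null sets and square integrability on the product space\<close>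

lemma (in sigma_finite_measure) AE_pair_fst:
  assumes "AE x in M. P x"
  shows "AE z in M \<Otimes>\<^sub>M M. P (fst z)"
proof -
  obtain N where N: "{x\<in>space M. \<not> P x} \<subseteq> N" "emeasure M N = 0" "N \<in> sets M"
    using assms by (rule AE_E)
  show ?thesis
  proof (rule AE_I)
    show "emeasure (M \<Otimes>\<^sub>M M) (N \<times> space M) = 0"
      using N by (simp add: emeasure_pair_measure_Times)
  qed (use N in \<open>auto simp: space_pair_measure\<close>)
qed

lemma (in sigma_finite_measure) AE_pair_snd:
  assumes "AE x in M. P x"
  shows "AE z in M \<Otimes>\<^sub>M M. P (snd z)"
proof -
  obtain N where N: "{x\<in>space M. \<not> P x} \<subseteq> N" "emeasure M N = 0" "N \<in> sets M"
    using assms by (rule AE_E)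
  show ?thesis
  proof (rule AE_I)
    show "emeasure (M \<Otimes>\<^sub>M M) (space M \<times> N) = 0"
      using N by (simp add: emeasure_pair_measure_Times)
  qed (use N in \<open>auto simp: space_pair_measure\<close>)
qed

lemma (in sigma_finite_measure) L2_tensor:
  fixes f g :: "'a \<Rightarrow> real"
  assumes f: "f \<in> L2 M" and g: "g \<in> L2 M"
  shows "(\<lambda>z. f (fst z) * g (snd z)) \<in> L2 (M \<Otimes>\<^sub>M M)"
proof -
  interpret P: pair_sigma_finite M M ..
  have [measurable]: "f \<in> borel_measurable M" "g \<in> borel_measurable M"
    using f g by (auto simp: L2_def)
  have "integrable (M \<Otimes>\<^sub>M M) (\<lambda>z. (norm (f (fst z) * g (snd z)))\<^sup>2)"
  proof (rule P.Fubini_integrable)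
    show "integrable M (\<lambda>x. \<integral>y. norm ((norm (f (fst (x, y)) * g (snd (x, y))))\<^sup>2) \<partial>M)"
      using L2_square_integrable[OF f] by (simp add: power_mult_distrib)
    show "AE x in M. integrable M (\<lambda>y. (norm (f (fst (x, y)) * g (snd (x, y))))\<^sup>2)"
      using L2_square_integrable[OF g] by (simp add: power_mult_distrib)
  qed measurable
  then show ?thesis by (simp add: L2_def)
qed

lemma L2_vec_nth: "f \<in> L2 M \<Longrightarrow> (\<lambda>x. f x $ i) \<in> L2 M"
  by (rule L2_bounded_linear[OF bounded_linear_vec_nth])

lemma (in sigma_finite_measure) L2_kernel_entry:
  fixes f g :: "'i \<Rightarrow> 'a \<Rightarrow> real^'p::finite"
  assumes "\<And>l. l \<in> I \<Longrightarrow> f l \<in> L2 M" "\<And>l. l \<in> I \<Longrightarrow> g l \<in> L2 M"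
  shows "(\<lambda>z. \<Sum>l\<in>I. c l * (f l (fst z) $ i * g l (snd z) $ j)) \<in> L2 (M \<Otimes>\<^sub>M M)"
  unfolding real_scaleR_def[symmetric, where a = "c _"] by (intro L2_lincomb L2_tensor L2_vec_nth assms)

section \<open>Thresholding on almost-everywhere classes\<close>

lemma AFT_cong:
  fixes \<epsilon> \<epsilon>' :: "'n::finite \<Rightarrow> real \<Rightarrow> real^'p::finite"
  assumes M: "sigma_finite_measure M" and s: "functional_thresholding M lam s"
    and \<epsilon>: "\<And>t. \<epsilon> t \<in> L2 M" "\<And>t. \<epsilon>' t \<in> L2 M" "\<And>t. AE u in M. \<epsilon> t u = \<epsilon>' t u"
    and S: "\<And>i j. (\<lambda>z. S z $ i $ j) \<in> L2 (M \<Otimes>\<^sub>M M)" "\<And>i j. (\<lambda>z. S' z $ i $ j) \<in> L2 (M \<Otimes>\<^sub>M M)"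
    and SS': "kernel_eq M S S'"
  shows "kernel_eq M (AFT M s \<epsilon> S) (AFT M s \<epsilon>' S')"
proof -
  interpret sigma_finite_measure M by fact
  have [measurable]: "\<epsilon> t \<in> borel_measurable M" "\<epsilon>' t \<in> borel_measurable M" for t
    using \<epsilon> by (auto simp: L2_def)
  have nth[measurable]: "(\<lambda>x. f x $ i) \<in> borel_measurable N" if "f \<in> borel_measurable N" for f :: "'z \<Rightarrow> real^'p" and i N
    by (rule borel_measurable_continuous_on[OF linear_continuous_on[OF bounded_linear_vec_nth] that])
  have Sm[measurable]: "(\<lambda>z. S z $ i $ j) \<in> borel_measurable (M \<Otimes>\<^sub>M M)"
    "(\<lambda>z. S' z $ i $ j) \<in> borel_measurable (M \<Otimes>\<^sub>M M)" for i j
    using S by (auto simp: L2_def)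
  have "AE u in M. \<forall>t. \<epsilon> t u = \<epsilon>' t u"
    using \<epsilon>(3) by (simp add: eventually_all_finite)
  then have "AE z in M \<Otimes>\<^sub>M M. (\<forall>t. \<epsilon> t (fst z) = \<epsilon>' t (fst z)) \<and> (\<forall>t. \<epsilon> t (snd z) = \<epsilon>' t (snd z))"
    using AE_pair_fst AE_pair_snd by auto
  moreover have SS: "AE z in M \<Otimes>\<^sub>M M. S z = S' z" using SS' by (simp add: kernel_eq_def)
  ultimately have var: "AE z in M \<Otimes>\<^sub>M M. variance_factor \<epsilon> S i j z = variance_factor \<epsilon>' S' i j z" for i j
    by eventually_elim (auto simp: variance_factor_def)
  have var_meas: "variance_factor \<epsilon> S i j \<in> borel_measurable (M \<Otimes>\<^sub>M M)"
    "variance_factor \<epsilon>' S' i j \<in> borel_measurable (M \<Otimes>\<^sub>M M)" for i j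
    unfolding variance_factor_def case_prod_beta' prod.collapse by measurable
  \<comment> \<open>The normalizing constant is defined by an integral, so it is literally equal for
    both inputs, and both entries are rescaled by the same number before \<open>s\<close> is
    applied.\<close>
  have w: "HS_norm M (\<lambda>z. sqrt (variance_factor \<epsilon> S i j z)) = HS_norm M (\<lambda>z. sqrt (variance_factor \<epsilon>' S' i j z))" for i j
  proof -
    have "(\<integral>z. (sqrt (variance_factor \<epsilon> S i j z))\<^sup>2 \<partial>(M \<Otimes>\<^sub>M M)) =
        (\<integral>z. (sqrt (variance_factor \<epsilon>' S' i j z))\<^sup>2 \<partial>(M \<Otimes>\<^sub>M M))"
    proof (rule integral_cong_AE)
      show "AE z in M \<Otimes>\<^sub>M M. (sqrt (variance_factor \<epsilon> S i j z))\<^sup>2 = (sqrt (variance_factor \<epsilon>' S' i j z))\<^sup>2"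
        using var[of i j] by eventually_elim simp
    qed (use var_meas[of i j] in measurable)
    then show ?thesis by (simp add: HS_norm_def)
  qed
  define W where "W i j = HS_norm M (\<lambda>z. sqrt (variance_factor \<epsilon> S i j z))" for i j
  \<comment> \<open>\<open>s\<close> acts on representatives; its compatibility with
    almost-everywhere equality is the second conjunct of
    \<open>functional_thresholding\<close>.\<close>
  have "AE z in M \<Otimes>\<^sub>M M. s (\<lambda>z'. S z' $ i $ j / W i j) z = s (\<lambda>z'. S' z' $ i $ j / W i j) z" for i j
  proof -
    have "(\<lambda>z. S z $ i $ j / W i j) \<in> L2 (M \<Otimes>\<^sub>M M)" "(\<lambda>z. S' z $ i $ j / W i j) \<in> L2 (M \<Otimes>\<^sub>M M)"
      using L2_scaleR[OF S(1), of "1 / W i j"] L2_scaleR[OF S(2), of "1 / W i j"] by simp_all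
    moreover have "kernel_eq M (\<lambda>z. S z $ i $ j / W i j) (\<lambda>z. S' z $ i $ j / W i j)"
      unfolding kernel_eq_def using SS by eventually_elim simp
    ultimately have "kernel_eq M (s (\<lambda>z. S z $ i $ j / W i j)) (s (\<lambda>z. S' z $ i $ j / W i j))"
      using s unfolding functional_thresholding_def by blast
    then show ?thesis by (simp add: kernel_eq_def)
  qed
  then have "AE z in M \<Otimes>\<^sub>M M. \<forall>i j. s (\<lambda>z'. S z' $ i $ j / W i j) z = s (\<lambda>z'. S' z' $ i $ j / W i j) z"
    by (simp add: eventually_all_finite)
  then show ?thesis
    unfolding kernel_eq_def
    by eventually_elim (simp add: AFT_def Let_def w[symmetric] W_def vec_eq_iff)
qed

section \<open>Constrained least squares\<close>

text \<open>The factor makes the constraint on \<Gamma> say exactly that these vectors are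
  orthonormal.\<close>

definition cls_score :: "real^'r^'n::finite \<Rightarrow> 'r \<Rightarrow> real^'n" where
  "cls_score \<Gamma> k = (1 / sqrt (real CARD('n))) *\<^sub>R column k \<Gamma>"

lemma column_cls_score: "column k \<Gamma> = sqrt (real CARD('n)) *\<^sub>R cls_score (\<Gamma> :: real^'r^'n::finite) k"
  by (simp add: cls_score_def)

lemma transpose_mult_entry: "(transpose A ** A) $ k $ l = column k A \<bullet> column l A"
  for A :: "real^'r::finite^'n::finite"
  by (simp add: matrix_matrix_mult_def transpose_def column_def inner_vec_def)

lemma orthonormal_cls_score_iff:
  fixes \<Gamma> :: "real^'r::finite^'n::finite"
  shows "orthonormal_on UNIV (cls_score \<Gamma>) \<longleftrightarrow> (1 / real CARD('n)) *\<^sub>R (transpose \<Gamma> ** \<Gamma>) = mat 1"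
proof -
  have "((1 / real CARD('n)) *\<^sub>R (transpose \<Gamma> ** \<Gamma>)) $ k $ l = cls_score \<Gamma> k \<bullet> cls_score \<Gamma> l" for k l
    unfolding vector_scaleR_component transpose_mult_entry by (simp add: cls_score_def)
  then show ?thesis by (simp only: vec_eq_iff orthonormal_on_def) (simp add: mat_def)
qed

lemma matrix_vector_mult_columns:
  fixes A :: "real^'r::finite^'p::finite"
  shows "A *v x = (\<Sum>k\<in>UNIV. x $ k *\<^sub>R column k A)"
  by (simp add: vec_eq_iff matrix_vector_mult_def column_def mult.commute)

lemma matrix_mult_transpose_columns:
  fixes A B :: "real^'r::finite^'p::finite"
  shows "A ** transpose B = (\<Sum>k\<in>UNIV. outer (column k A) (column k B))"
  by (simp add: vec_eq_iff matrix_matrix_mult_def transpose_def outer_def column_def)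

lemma L2_column:
  fixes Q :: "real \<Rightarrow> real^'r::finite^'p::finite"
  assumes "Q \<in> L2 M"
  shows "(\<lambda>u. column k (Q u)) \<in> L2 M"
proof (rule L2_bounded_linear[OF _ assms])
  show "bounded_linear (\<lambda>A. column k (A :: real^'r^'p))"
    unfolding linear_conv_bounded_linear[symmetric]
    by (rule linearI) (simp_all add: column_def vec_eq_iff)
qed

lemma L2_of_columns:
  fixes q :: "'r::finite \<Rightarrow> real \<Rightarrow> real^'p::finite"
  assumes "\<And>k. q k \<in> L2 M"
  shows "(\<lambda>u. \<chi> i k. q k u $ i) \<in> L2 M"
proof -
  define place :: "'r \<Rightarrow> real^'p \<Rightarrow> real^'r^'p" where
    "place k x = (\<chi> i l. if l = k then x $ i else 0)" for k x
  have "bounded_linear (place k)" for k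
    unfolding linear_conv_bounded_linear[symmetric]
    by (rule linearI) (simp_all add: place_def vec_eq_iff)
  then have "(\<lambda>u. place k (q k u)) \<in> L2 M" for k
    by (rule L2_bounded_linear[OF _ assms])
  then have "(\<lambda>u. \<Sum>k\<in>UNIV. place k (q k u)) \<in> L2 M"
    by (intro L2_sum)
  moreover have "(\<Sum>k\<in>UNIV. place k (q k u)) = (\<chi> i k. q k u $ i)" for u
    by (simp add: vec_eq_iff place_def)
  ultimately show ?thesis by simp
qed

text \<open>Taking an entry commutes with the Bochner integral; for a non-integrable function the
  integral is 0 by default, so the entry is 0 in that case too.\<close>

lemma integral_transpose_mult_entry:
  fixes Q :: "real \<Rightarrow> real^'r::finite^'p::finite"
  assumes "L2_inner M (\<lambda>u. column k (Q u)) (\<lambda>u. column l (Q u)) = 0"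
  shows "(\<integral>u. transpose (Q u) ** Q u \<partial>M) $ k $ l = 0"
proof (cases "integrable M (\<lambda>u. transpose (Q u) ** Q u)")
  case True
  have "bounded_linear (\<lambda>A :: real^'r^'r. A $ k $ l)"
    by (intro bounded_linear_compose[OF bounded_linear_vec_nth bounded_linear_vec_nth])
  from integral_bounded_linear[OF this True] assms show ?thesis
    by (simp add: transpose_mult_entry L2_inner_def)
qed (simp add: not_integrable_integral_eq)

text \<open>Completing the square: the orthonormal scores decouple the vectors \<open>q k\<close>,
  and \<open>z k\<close> is the regression coefficient of the data on column \<open>k\<close> of
  \<Gamma>. Only the last sum depends on \<open>q\<close>.\<close>

lemma least_squares_identity:
  fixes y :: "'n::finite \<Rightarrow> 'a::real_inner" and q :: "'r::finite \<Rightarrow> 'a" and \<Gamma> :: "real^'r^'n"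
  assumes on: "orthonormal_on UNIV (cls_score \<Gamma>)"
    and z: "\<And>k. z k = (1 / real CARD('n)) *\<^sub>R (\<Sum>t\<in>UNIV. \<Gamma> $ t $ k *\<^sub>R y t)"
  shows "(\<Sum>t\<in>UNIV. (norm (y t - (\<Sum>k\<in>UNIV. \<Gamma> $ t $ k *\<^sub>R q k)))\<^sup>2) =
    (\<Sum>t\<in>UNIV. y t \<bullet> y t) - real CARD('n) * (\<Sum>k\<in>UNIV. z k \<bullet> z k)
      + real CARD('n) * (\<Sum>k\<in>UNIV. (q k - z k) \<bullet> (q k - z k))"
proof -
  let ?n = "real CARD('n)"
  have gg: "(\<Sum>t\<in>UNIV. \<Gamma> $ t $ k * \<Gamma> $ t $ l) = (if k = l then ?n else 0)" for k l
  proof -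
    have "column k \<Gamma> \<bullet> column l \<Gamma> = ?n * (cls_score \<Gamma> k \<bullet> cls_score \<Gamma> l)"
      unfolding column_cls_score by simp
    then show ?thesis using on by (simp add: orthonormal_on_def column_def inner_vec_def)
  qed
  have cross: "(\<Sum>t\<in>UNIV. y t \<bullet> (\<Sum>k\<in>UNIV. \<Gamma> $ t $ k *\<^sub>R q k)) = ?n * (\<Sum>k\<in>UNIV. q k \<bullet> z k)"
  proof -
    have "(\<Sum>t\<in>UNIV. y t \<bullet> (\<Sum>k\<in>UNIV. \<Gamma> $ t $ k *\<^sub>R q k)) = (\<Sum>t\<in>UNIV. \<Sum>k\<in>UNIV. \<Gamma> $ t $ k * (q k \<bullet> y t))"
      by (simp add: inner_sum_right inner_commute)
    also have "\<dots> = (\<Sum>k\<in>UNIV. \<Sum>t\<in>UNIV. \<Gamma> $ t $ k * (q k \<bullet> y t))" by (rule sum.swap)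
    finally show ?thesis by (simp add: z inner_sum_right sum_distrib_left)
  qed
  have quad: "(\<Sum>t\<in>UNIV. (\<Sum>k\<in>UNIV. \<Gamma> $ t $ k *\<^sub>R q k) \<bullet> (\<Sum>k\<in>UNIV. \<Gamma> $ t $ k *\<^sub>R q k)) = ?n * (\<Sum>k\<in>UNIV. q k \<bullet> q k)"
  proof -
    have "(\<Sum>t\<in>UNIV. (\<Sum>k\<in>UNIV. \<Gamma> $ t $ k *\<^sub>R q k) \<bullet> (\<Sum>k\<in>UNIV. \<Gamma> $ t $ k *\<^sub>R q k)) =
      (\<Sum>t\<in>UNIV. \<Sum>k\<in>UNIV. \<Sum>l\<in>UNIV. \<Gamma> $ t $ k * \<Gamma> $ t $ l * (q k \<bullet> q l))"
      by (simp add: inner_sum_right inner_sum_left sum_distrib_left mult_ac inner_commute)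
    also have "\<dots> = (\<Sum>k\<in>UNIV. \<Sum>t\<in>UNIV. \<Sum>l\<in>UNIV. \<Gamma> $ t $ k * \<Gamma> $ t $ l * (q k \<bullet> q l))" by (rule sum.swap)
    also have "\<dots> = (\<Sum>k\<in>UNIV. \<Sum>l\<in>UNIV. \<Sum>t\<in>UNIV. \<Gamma> $ t $ k * \<Gamma> $ t $ l * (q k \<bullet> q l))"
      by (intro sum.cong refl sum.swap)
    also have "\<dots> = (\<Sum>k\<in>UNIV. \<Sum>l\<in>UNIV. (if k = l then ?n else 0) * (q k \<bullet> q l))"
      by (simp add: gg flip: sum_distrib_right)
    also have "\<dots> = (\<Sum>k\<in>UNIV. \<Sum>l\<in>UNIV. (if k = l then ?n * (q k \<bullet> q l) else 0))"
      by (intro sum.cong refl) auto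
    finally show ?thesis by (simp add: sum_distrib_left)
  qed
  have "(\<Sum>t\<in>UNIV. (norm (y t - (\<Sum>k\<in>UNIV. \<Gamma> $ t $ k *\<^sub>R q k)))\<^sup>2) =
    (\<Sum>t\<in>UNIV. y t \<bullet> y t) - 2 * (\<Sum>t\<in>UNIV. y t \<bullet> (\<Sum>k\<in>UNIV. \<Gamma> $ t $ k *\<^sub>R q k)) +
    (\<Sum>t\<in>UNIV. (\<Sum>k\<in>UNIV. \<Gamma> $ t $ k *\<^sub>R q k) \<bullet> (\<Sum>k\<in>UNIV. \<Gamma> $ t $ k *\<^sub>R q k))"
  proof -
    have "(norm (a - b))\<^sup>2 = a \<bullet> a - 2 * (a \<bullet> b) + b \<bullet> b" for a b :: 'a
      by (simp add: power2_norm_eq_inner inner_diff_left inner_diff_right inner_commute)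
    then show ?thesis by (simp only: sum.distrib sum_subtractf sum_distrib_left)
  qed
  moreover have "(\<Sum>k\<in>UNIV. (q k - z k) \<bullet> (q k - z k)) =
      (\<Sum>k\<in>UNIV. q k \<bullet> q k) - 2 * (\<Sum>k\<in>UNIV. q k \<bullet> z k) + (\<Sum>k\<in>UNIV. z k \<bullet> z k)"
  proof -
    have "(a - b) \<bullet> (a - b) = a \<bullet> a - 2 * (a \<bullet> b) + b \<bullet> b" for a b :: 'a
      by (simp add: inner_diff_left inner_diff_right inner_commute)
    then show ?thesis by (simp only: sum.distrib sum_subtractf sum_distrib_left)
  qed
  ultimately show ?thesis
    unfolding cross quad by (simp only: ring_distribs)
qed

definition cls_loading :: "('n::finite \<Rightarrow> real \<Rightarrow> real^'p) \<Rightarrow> real^'r^'n \<Rightarrow> 'r \<Rightarrow> real \<Rightarrow> real^'p::finite" where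
  "cls_loading y \<Gamma> k u = (1 / real CARD('n)) *\<^sub>R synth y (column k \<Gamma>) u"

lemma cls_loading_L2: "(\<And>t. y t \<in> L2 M) \<Longrightarrow> cls_loading y \<Gamma> k \<in> L2 M"
  unfolding cls_loading_def[abs_def] by (intro L2_scaleR synth_L2)

lemma L2_inner_cls_loading:
  fixes y :: "'n::finite \<Rightarrow> real \<Rightarrow> real^'p::finite"
  assumes "\<And>t. y t \<in> L2 M"
  shows "L2_inner M (cls_loading y \<Gamma> k) (cls_loading y \<Gamma> l) = cls_score \<Gamma> k \<bullet> gram M y (cls_score \<Gamma> l)"
  unfolding cls_loading_def[abs_def] L2_inner_scaleR_left L2_inner_scaleR_right
    L2_inner_synth_synth[where y = y, OF assms] column_cls_score linear_cmul[OF linear_gram]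
  by (simp add: field_simps)

text \<open>Pointwise in \<open>u\<close>, the squared Frobenius norm is a sum over the columns, to
  which \<open>least_squares_identity\<close> applies; integration gives the three terms. For fixed
  scores the last one is the excess over the best loadings, which are the columns of
  \<open>n^-1 Y \<Gamma>\<close>.\<close>

lemma cls_objective_eq:
  fixes y :: "'n::finite \<Rightarrow> real \<Rightarrow> real^'p::finite" and Q :: "real \<Rightarrow> real^'r::finite^'p"
  assumes y: "\<And>t. y t \<in> L2 M" and Q: "Q \<in> L2 M" and on: "orthonormal_on UNIV (cls_score \<Gamma>)"
  shows "cls_objective M y Q \<Gamma> = (\<Sum>t\<in>UNIV. L2_inner M (y t) (y t))
    - real CARD('n) * (\<Sum>k\<in>UNIV. cls_score \<Gamma> k \<bullet> gram M y (cls_score \<Gamma> k))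
    + real CARD('n) * (\<Sum>k\<in>UNIV. L2_inner M (\<lambda>u. column k (Q u) - cls_loading y \<Gamma> k u)
        (\<lambda>u. column k (Q u) - cls_loading y \<Gamma> k u))"
proof -
  let ?z = "cls_loading y \<Gamma>" and ?d = "\<lambda>k u. column k (Q u) - cls_loading y \<Gamma> k u"
  have z: "?z k \<in> L2 M" for k by (rule cls_loading_L2) (rule y)
  have d: "?d k \<in> L2 M" for k by (intro L2_diff L2_column Q z)
  have "(norm (data_matrix y u - Q u ** transpose \<Gamma>))\<^sup>2 =
    (\<Sum>t\<in>UNIV. (norm (y t u - (\<Sum>k\<in>UNIV. \<Gamma> $ t $ k *\<^sub>R column k (Q u))))\<^sup>2)" for u
  proof -
    have "(norm (data_matrix y u - Q u ** transpose \<Gamma>))\<^sup>2 =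
      (\<Sum>i\<in>UNIV. \<Sum>t\<in>UNIV. (y t u $ i - (\<Sum>k\<in>UNIV. \<Gamma> $ t $ k * Q u $ i $ k))\<^sup>2)"
      unfolding power2_norm_eq_inner
      by (simp add: inner_vec_def data_matrix_def matrix_matrix_mult_def transpose_def
          power2_eq_square mult.commute)
    also have "\<dots> = (\<Sum>t\<in>UNIV. \<Sum>i\<in>UNIV. (y t u $ i - (\<Sum>k\<in>UNIV. \<Gamma> $ t $ k * Q u $ i $ k))\<^sup>2)"
      by (rule sum.swap)
    finally show ?thesis
      unfolding power2_norm_eq_inner by (simp add: inner_vec_def column_def power2_eq_square)
  qed
  also have "(\<Sum>t\<in>UNIV. (norm (y t u - (\<Sum>k\<in>UNIV. \<Gamma> $ t $ k *\<^sub>R column k (Q u))))\<^sup>2) =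
    (\<Sum>t\<in>UNIV. y t u \<bullet> y t u) - real CARD('n) * (\<Sum>k\<in>UNIV. ?z k u \<bullet> ?z k u)
      + real CARD('n) * (\<Sum>k\<in>UNIV. ?d k u \<bullet> ?d k u)" for u
    by (rule least_squares_identity[OF on]) (simp add: cls_loading_def synth_def column_def)
  finally have "cls_objective M y Q \<Gamma> = (\<integral>u. (\<Sum>t\<in>UNIV. y t u \<bullet> y t u) - real CARD('n) * (\<Sum>k\<in>UNIV. ?z k u \<bullet> ?z k u)
      + real CARD('n) * (\<Sum>k\<in>UNIV. ?d k u \<bullet> ?d k u) \<partial>M)"
    by (simp add: cls_objective_def)
  also have "\<dots> = (\<Sum>t\<in>UNIV. L2_inner M (y t) (y t)) - real CARD('n) * (\<Sum>k\<in>UNIV. L2_inner M (?z k) (?z k))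
      + real CARD('n) * (\<Sum>k\<in>UNIV. L2_inner M (?d k) (?d k))"
  proof -
    have has: "has_bochner_integral M (\<lambda>u. f u \<bullet> f u) (L2_inner M f f)" if "f \<in> L2 M" for f :: "real \<Rightarrow> real^'p"
      unfolding L2_inner_def by (rule has_bochner_integral_integrable[OF L2_inner_integrable[OF that that]])
    show ?thesis
      by (rule has_bochner_integral_integral_eq)
        (intro has_bochner_integral_add has_bochner_integral_diff has_bochner_integral_sum
          has_bochner_integral_mult_right has y z d)
  qed
  finally show ?thesis by (simp add: L2_inner_cls_loading[where y = y, OF y])
qed

section \<open>Minimizers of the constrained problem\<close>

lemma cls_objective_ge:
  fixes y :: "'n::finite \<Rightarrow> real \<Rightarrow> real^'p::finite" and Q :: "real \<Rightarrow> real^'r::finite^'p"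
  assumes y: "\<And>t. y t \<in> L2 M" and feas: "cls_feasible M Q \<Gamma>"
    and basis: "sorted_eigenbasis (gram M y) \<tau> w" and r: "r = CARD('r)" "r \<le> CARD('n)"
  shows "(\<Sum>t\<in>UNIV. L2_inner M (y t) (y t)) - real CARD('n) * (\<Sum>j<r. \<tau> j) \<le> cls_objective M y Q \<Gamma>"
proof -
  have Q: "Q \<in> L2 M" and on: "orthonormal_on UNIV (cls_score \<Gamma>)"
    using feas by (simp_all add: cls_feasible_def orthonormal_cls_score_iff)
  have "(\<Sum>k\<in>UNIV. cls_score \<Gamma> k \<bullet> gram M y (cls_score \<Gamma> k)) \<le> (\<Sum>j<r. \<tau> j)"
    using r by (intro ky_fan_le[OF basis gram_symmetric on]) (simp_all add: y)
  then have "real CARD('n) * (\<Sum>k\<in>UNIV. cls_score \<Gamma> k \<bullet> gram M y (cls_score \<Gamma> k)) \<le> real CARD('n) * (\<Sum>j<r. \<tau> j)"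
    by (intro mult_left_mono) auto
  moreover have "0 \<le> real CARD('n) * (\<Sum>k\<in>UNIV. L2_inner M (\<lambda>u. column k (Q u) - cls_loading y \<Gamma> k u)
        (\<lambda>u. column k (Q u) - cls_loading y \<Gamma> k u))"
    by (intro mult_nonneg_nonneg sum_nonneg L2_inner_self_nonneg) auto
  ultimately show ?thesis
    unfolding cls_objective_eq[OF y Q on] by linarith
qed

text \<open>Scores equal to \<open>sqrt n\<close> times the leading eigenvectors, with their
  regression loadings, attain equality in Ky Fan's bound and leave no excess term. The loadings are
  orthogonal because distinct \<open>w j\<close> are orthogonal eigenvectors of \<open>gram\<close>,
  so the diagonality constraint holds.\<close>

lemma cls_solution_of_eigenbasis:
  fixes y :: "'n::finite \<Rightarrow> real \<Rightarrow> real^'p::finite"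
  assumes y: "\<And>t. y t \<in> L2 M"
    and basis: "sorted_eigenbasis (gram M y) \<tau> w" and r: "r = CARD('r::finite)" "r \<le> CARD('n)"
  obtains Q :: "real \<Rightarrow> real^'r^'p" and \<Gamma> :: "real^'r^'n" where "cls_solution M y Q \<Gamma>"
    "\<And>j. j < CARD('n) \<Longrightarrow> span_proj (cls_score \<Gamma>) (w j) = (if j < r then w j else 0)"
    "cls_objective M y Q \<Gamma> = (\<Sum>t\<in>UNIV. L2_inner M (y t) (y t)) - real CARD('n) * (\<Sum>j<r. \<tau> j)"
proof -
  \<comment> \<open>The columns may be enumerated in any order, as the constraint asks for a
    diagonal matrix and not for sorted entries.\<close>
  obtain f :: "'r \<Rightarrow> nat" where f: "bij_betw f UNIV {..<r}"
    using ex_bij_betw_finite_nat[of "UNIV :: 'r set"] r(1) by (auto simp: lessThan_atLeast0)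
  have fr: "f k < r" for k using f by (auto simp: bij_betw_def)
  have fn: "f k < CARD('n)" for k using fr[of k] r(2) by simp
  have inj: "f k = f l \<longleftrightarrow> k = l" for k l using f by (auto simp: bij_betw_def inj_eq)
  have won: "w i \<bullet> w j = (if i = j then 1 else 0)" if "i < CARD('n)" "j < CARD('n)" for i j
    using basis that by (simp add: sorted_eigenbasis_def orthonormal_on_def)
  have eig: "gram M y (w j) = \<tau> j *\<^sub>R w j" if "j < CARD('n)" for j
    using basis that by (simp add: sorted_eigenbasis_def)
  define \<Gamma> :: "real^'r^'n" where "\<Gamma> = (\<chi> t k. sqrt (real CARD('n)) * w (f k) $ t)"
  define Q :: "real \<Rightarrow> real^'r^'p" where "Q u = (\<chi> i k. cls_loading y \<Gamma> k u $ i)" for u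
  have score: "cls_score \<Gamma> k = w (f k)" for k
    by (simp add: cls_score_def \<Gamma>_def column_def vec_eq_iff)
  have on: "orthonormal_on UNIV (cls_score \<Gamma>)"
    by (auto simp: orthonormal_on_def score won fn inj)
  have Q: "Q \<in> L2 M" unfolding Q_def[abs_def] by (intro L2_of_columns cls_loading_L2 y)
  have col: "column k (Q u) = cls_loading y \<Gamma> k u" for k u
    by (simp add: Q_def column_def vec_eq_iff)
  have "(\<integral>u. transpose (Q u) ** Q u \<partial>M) $ k $ l = 0" if "k \<noteq> l" for k l
  proof (rule integral_transpose_mult_entry)
    show "L2_inner M (\<lambda>u. column k (Q u)) (\<lambda>u. column l (Q u)) = 0"
      using that L2_inner_cls_loading[where y = y and M = M, OF y, of \<Gamma> k l]
      by (simp add: col score eig fn won inj)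
  qed
  then have feas: "cls_feasible M Q \<Gamma>"
    using Q on by (simp add: cls_feasible_def orthonormal_cls_score_iff)
  have "(\<Sum>k\<in>UNIV. \<tau> (f k)) = (\<Sum>j<r. \<tau> j)"
    using sum.reindex_bij_betw[OF f, of \<tau>] .
  then have obj: "cls_objective M y Q \<Gamma> = (\<Sum>t\<in>UNIV. L2_inner M (y t) (y t)) - real CARD('n) * (\<Sum>j<r. \<tau> j)"
    unfolding cls_objective_eq[OF y Q on] by (simp add: col score eig fn won L2_inner_def)
  have sol: "cls_solution M y Q \<Gamma>"
    unfolding cls_solution_def obj using feas cls_objective_ge[where y = y, OF y _ basis r] by blast
  have "span_proj (cls_score \<Gamma>) (w j) = (if j < r then w j else 0)" if j: "j < CARD('n)" for j
  proof (cases "j < r")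
    case True
    then obtain k where "j = f k" using f by (auto simp: bij_betw_def image_iff set_eq_iff)
    then have "w j \<in> span (range (cls_score \<Gamma>))" by (auto simp: score intro: span_base)
    then show ?thesis using True span_proj_id[OF on] by simp
  next
    case False
    then have "cls_score \<Gamma> k \<bullet> w j = 0" for k
      using fr[of k] j fn[of k] by (auto simp: score won)
    then show ?thesis using False span_proj_orthogonal[of "cls_score \<Gamma>"] by simp
  qed
  then show ?thesis using that[OF sol _ obj] by blast
qed

text \<open>The objective exceeds the attained lower bound by \<open>n\<close> times the sum of the
  Ky Fan defect and the loading excess. Both are nonnegative, so optimality makes both
  vanish.\<close>

lemma cls_solution_optimality:
  fixes y :: "'n::finite \<Rightarrow> real \<Rightarrow> real^'p::finite" and Q :: "real \<Rightarrow> real^'r::finite^'p"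
  assumes y: "\<And>t. y t \<in> L2 M" and sol: "cls_solution M y Q \<Gamma>"
    and basis: "sorted_eigenbasis (gram M y) \<tau> w" and r: "r = CARD('r)" "r \<le> CARD('n)"
  shows cls_solution_score: "orthonormal_on UNIV (cls_score \<Gamma>)"
    and cls_solution_L2: "Q \<in> L2 M"
    and cls_solution_trace: "(\<Sum>k\<in>UNIV. cls_score \<Gamma> k \<bullet> gram M y (cls_score \<Gamma> k)) = (\<Sum>j<r. \<tau> j)"
    and cls_solution_loading: "AE u in M. column k (Q u) = cls_loading y \<Gamma> k u"
proof -
  have feas: "cls_feasible M Q \<Gamma>" using sol by (simp add: cls_solution_def)
  then show Q: "Q \<in> L2 M" and on: "orthonormal_on UNIV (cls_score \<Gamma>)"
    by (simp_all add: cls_feasible_def orthonormal_cls_score_iff)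
  obtain Q' :: "real \<Rightarrow> real^'r^'p" and \<Gamma>' :: "real^'r^'n" where "cls_solution M y Q' \<Gamma>'"
    and obj': "cls_objective M y Q' \<Gamma>' = (\<Sum>t\<in>UNIV. L2_inner M (y t) (y t)) - real CARD('n) * (\<Sum>j<r. \<tau> j)"
    using cls_solution_of_eigenbasis[where y = y, OF y basis r] by blast
  then have le: "cls_objective M y Q \<Gamma> \<le> cls_objective M y Q' \<Gamma>'"
    using sol unfolding cls_solution_def by blast
  let ?d = "\<lambda>k u. column k (Q u) - cls_loading y \<Gamma> k u"
  let ?T = "\<Sum>k\<in>UNIV. cls_score \<Gamma> k \<bullet> gram M y (cls_score \<Gamma> k)"
  have T: "?T \<le> (\<Sum>j<r. \<tau> j)"
    using r by (intro ky_fan_le[OF basis gram_symmetric on]) (simp_all add: y)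
  have D: "0 \<le> (\<Sum>k\<in>UNIV. L2_inner M (?d k) (?d k))"
    by (intro sum_nonneg L2_inner_self_nonneg)
  have "real CARD('n) * (((\<Sum>j<r. \<tau> j) - ?T) + (\<Sum>k\<in>UNIV. L2_inner M (?d k) (?d k))) \<le> 0"
    using le unfolding obj' cls_objective_eq[OF y Q on] by (simp add: algebra_simps)
  then have le0: "((\<Sum>j<r. \<tau> j) - ?T) + (\<Sum>k\<in>UNIV. L2_inner M (?d k) (?d k)) \<le> 0"
    by (simp add: mult_le_0_iff)
  with T D show "?T = (\<Sum>j<r. \<tau> j)" by linarith
  have "(\<Sum>k\<in>UNIV. L2_inner M (?d k) (?d k)) = 0" using le0 T D by linarith
  then have "L2_inner M (?d k) (?d k) = 0"
    by (simp add: sum_nonneg_eq_0_iff L2_inner_self_nonneg)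
  moreover have "?d k \<in> L2 M" by (intro L2_diff L2_column Q cls_loading_L2 y)
  ultimately have "AE u in M. ?d k u = 0" by (intro L2_inner_self_eq_0)
  then show "AE u in M. column k (Q u) = cls_loading y \<Gamma> k u" by simp
qed

section \<open>Spectral sums of outer products\<close>

lemma orth_complement_finite:
  assumes "\<And>j. N \<le> j \<Longrightarrow> \<tau> j = 0"
  shows "orth_complement r \<tau> \<phi> (u, v) = (\<Sum>j=r..<N. \<tau> j *\<^sub>R outer (\<phi> j u) (\<phi> j v))"
proof -
  have "orth_complement r \<tau> \<phi> (u, v) = (\<Sum>j<N - r. \<tau> (r + j) *\<^sub>R outer (\<phi> (r + j) u) (\<phi> (r + j) v))"
    unfolding orth_complement_def prod.case by (rule suminf_finite) (auto simp: assms)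
  also have "\<dots> = (\<Sum>j=r..<N. \<tau> j *\<^sub>R outer (\<phi> j u) (\<phi> j v))"
    by (rule sum.reindex_bij_witness[of _ "\<lambda>j. j - r" "\<lambda>j. r + j"]) auto
  finally show ?thesis .
qed

lemma bilinear_outer: "bilinear outer"
  unfolding bilinear_def
  by (auto intro!: linearI simp: outer_def vec_eq_iff algebra_simps)

lemma outer_lincomb:
  assumes "finite I"
  shows "outer (\<Sum>j\<in>I. c j *\<^sub>R x j) (\<Sum>j\<in>I. d j *\<^sub>R z j) = (\<Sum>i\<in>I. \<Sum>j\<in>I. (c i * d j) *\<^sub>R outer (x i) (z j))"
  using assms
  by (simp add: bilinear_sum[OF bilinear_outer] sum.cartesian_product bilinear_lmul[OF bilinear_outer]
      bilinear_rmul[OF bilinear_outer] case_prod_beta' mult.commute)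

text \<open>Summation over \<open>t\<close> removes the mixed outer products. With
  \<open>I = J = {r..<n}\<close> this yields the covariance of the residuals, with
  \<open>I = {..<n}\<close> and \<open>J = {..<r}\<close> the product of the loadings;
  \<open>x\<close> and \<open>z\<close> hold the eigenfunctions at the two arguments of the
  kernel.\<close>

lemma sum_outer_lincomb_diagonal:
  fixes x z :: "'i \<Rightarrow> real^'p"
  assumes "finite I" "finite T" "J \<subseteq> I"
    and diag: "\<And>i j. i \<in> I \<Longrightarrow> j \<in> I \<Longrightarrow> (\<Sum>t\<in>T. c t i * c t j) = (if i = j \<and> i \<in> J then m i else 0)"
  shows "(\<Sum>t\<in>T. outer (\<Sum>j\<in>I. c t j *\<^sub>R x j) (\<Sum>j\<in>I. c t j *\<^sub>R z j)) = (\<Sum>j\<in>J. m j *\<^sub>R outer (x j) (z j))"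
proof -
  have "(\<Sum>t\<in>T. outer (\<Sum>j\<in>I. c t j *\<^sub>R x j) (\<Sum>j\<in>I. c t j *\<^sub>R z j)) =
      (\<Sum>t\<in>T. \<Sum>i\<in>I. \<Sum>j\<in>I. (c t i * c t j) *\<^sub>R outer (x i) (z j))"
    by (simp add: outer_lincomb assms(1))
  also have "\<dots> = (\<Sum>i\<in>I. \<Sum>t\<in>T. \<Sum>j\<in>I. (c t i * c t j) *\<^sub>R outer (x i) (z j))" by (rule sum.swap)
  also have "\<dots> = (\<Sum>i\<in>I. \<Sum>j\<in>I. \<Sum>t\<in>T. (c t i * c t j) *\<^sub>R outer (x i) (z j))"
    by (intro sum.cong refl sum.swap)
  also have "\<dots> = (\<Sum>i\<in>I. \<Sum>j\<in>I. if i = j then (if i \<in> J then m i *\<^sub>R outer (x i) (z i) else 0) else 0)"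
    by (intro sum.cong refl) (auto simp: diag scaleR_sum_left[symmetric])
  also have "\<dots> = (\<Sum>i\<in>I. if i \<in> J then m i *\<^sub>R outer (x i) (z i) else 0)"
    by (simp add: assms(1))
  also have "\<dots> = (\<Sum>j\<in>J. m j *\<^sub>R outer (x j) (z j))"
    using assms(1,3) by (simp add: sum.inter_restrict[symmetric] Int_absorb1)
  finally show ?thesis .
qed

text \<open>Everything is expanded in the eigenfunctions. The coefficients of a fitted observation
  arise by applying the projection to the \<open>w j\<close>, so under \<open>proj\<close> the fit
  is the expansion truncated to \<open>j < r\<close>; the residuals then agree, and the product of
  the loadings is the leading part. All coefficients carry the factor
  \<open>sqrt (\<tau> j)\<close>, which is why \<open>proj\<close> speaks of positive
  eigenvalues.\<close>

lemma fpoet_eq_cls: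
  fixes y :: "'n::finite \<Rightarrow> real \<Rightarrow> real^'p::finite" and Q :: "real \<Rightarrow> real^'r::finite^'p"
  assumes M: "sigma_finite_measure M" and s: "functional_thresholding M lam s"
    and y: "\<And>t. y t \<in> L2 M" and r: "r \<le> CARD('n)"
    and es: "eigensystem M (sample_cov y) \<tau> \<phi>"
    and basis: "sorted_eigenbasis (gram M y) \<tau> w"
    and link: "\<And>j t. j < CARD('n) \<Longrightarrow> L2_inner M (y t) (\<phi> j) = sqrt (real CARD('n) * \<tau> j) * w j $ t"
    and Q: "Q \<in> L2 M" and on: "orthonormal_on UNIV (cls_score \<Gamma>)"
    and loading: "\<And>k. AE u in M. column k (Q u) = cls_loading y \<Gamma> k u"
    and proj: "\<And>j. j < CARD('n) \<Longrightarrow> 0 < \<tau> j \<Longrightarrow> span_proj (cls_score \<Gamma>) (w j) = (if j < r then w j else 0)"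
  shows "kernel_eq M (fpoet M s y r \<tau> \<phi>) (cls_estimator M s y Q \<Gamma>) \<and>
    kernel_eq M (fpoet_R_AFT M s y r \<tau> \<phi>) (cls_error_AFT M s y Q \<Gamma>)"
proof -
  interpret sigma_finite_measure M by fact
  let ?n = "CARD('n)" and ?g = "cls_score \<Gamma>"
  have phi: "\<phi> j \<in> L2 M" for j using es by (simp add: eigensystem_def)
  have tau: "0 \<le> \<tau> j" for j using es by (simp add: eigensystem_def)
  have tau0: "\<tau> j = 0" if "?n \<le> j" for j using that by (rule eigensystem_rank[OF y es])
  have ww: "w i \<bullet> w j = (if i = j then 1 else 0)" if "i < ?n" "j < ?n" for i j
    using basis that by (simp add: sorted_eigenbasis_def orthonormal_on_def)
  have sproj: "sqrt (\<tau> j) *\<^sub>R span_proj ?g (w j) = (if j < r then sqrt (\<tau> j) *\<^sub>R w j else 0)" if "j < ?n" for j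
    using proj[OF that] tau[of j] by (cases "\<tau> j = 0") auto
  define v where "v t j = sqrt (real ?n * \<tau> j) * w j $ t" for t j
  \<comment> \<open>The coefficient of column \<open>k\<close> of \<open>Q\<close> at
    \<open>\<phi> j\<close>: the factor \<open>1 / n\<close> of the loading cancels against
    \<open>sqrt n\<close> from the score and \<open>sqrt n\<close> from \<open>v\<close>.\<close>
  define q where "q k j = sqrt (\<tau> j) * (?g k \<bullet> w j)" for k j
  have "AE u in M. \<forall>t. y t u = (\<Sum>j<?n. L2_inner M (y t) (\<phi> j) *\<^sub>R \<phi> j u)"
    using eigensystem_expansion[OF y es] by (simp add: eventually_all_finite)
  then have yexp: "AE u in M. \<forall>t. y t u = (\<Sum>j<?n. v t j *\<^sub>R \<phi> j u)"
    by (simp add: link v_def)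
  have qexp: "AE u in M. \<forall>k. column k (Q u) = (\<Sum>j<?n. q k j *\<^sub>R \<phi> j u)"
  proof -
    have "AE u in M. \<forall>k. column k (Q u) = cls_loading y \<Gamma> k u"
      using loading by (simp add: eventually_all_finite)
    then show ?thesis using yexp
    proof eventually_elim
      case (elim u)
      have "cls_loading y \<Gamma> k u = (\<Sum>j<?n. q k j *\<^sub>R \<phi> j u)" for k
      proof -
        have "synth y (column k \<Gamma>) u = (\<Sum>t\<in>UNIV. \<Sum>j<?n. (column k \<Gamma> $ t * v t j) *\<^sub>R \<phi> j u)"
          using elim(2) by (simp add: synth_def scaleR_sum_right)
        also have "\<dots> = (\<Sum>j<?n. \<Sum>t\<in>UNIV. (column k \<Gamma> $ t * v t j) *\<^sub>R \<phi> j u)" by (rule sum.swap)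
        also have "\<dots> = (\<Sum>j<?n. (sqrt (real ?n * \<tau> j) * (column k \<Gamma> \<bullet> w j)) *\<^sub>R \<phi> j u)"
          by (simp add: scaleR_sum_left[symmetric] v_def inner_vec_def sum_distrib_left mult_ac)
        finally have "cls_loading y \<Gamma> k u =
            (\<Sum>j<?n. ((1 / real ?n) * (sqrt (real ?n * \<tau> j) * (column k \<Gamma> \<bullet> w j))) *\<^sub>R \<phi> j u)"
          by (simp add: cls_loading_def scaleR_sum_right)
        moreover have "(1 / real ?n) * (sqrt (real ?n * \<tau> j) * (column k \<Gamma> \<bullet> w j)) = q k j" for j
        proof -
          have sq: "sqrt (real ?n) * (sqrt (real ?n) * x) = real ?n * x" for x
            by (simp flip: mult.assoc)
          show ?thesis by (simp add: column_cls_score q_def real_sqrt_mult mult_ac sq)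
        qed
        ultimately show ?thesis by simp
      qed
      then show ?case using elim(1) by simp
    qed
  qed
  have split: "(\<Sum>j<?n. f j) = (\<Sum>j<r. f j) + (\<Sum>j=r..<?n. f j)" for f :: "nat \<Rightarrow> real^'p"
    using r sum.atLeastLessThan_concat[of 0 r ?n f] by (simp add: lessThan_atLeast0)
  have pc: "AE u in M. \<forall>t. pc_residual M y r \<phi> t u = (\<Sum>j=r..<?n. v t j *\<^sub>R \<phi> j u)"
    using yexp
  proof eventually_elim
    case (elim u)
    have "L2_inner M (y t) (\<phi> j) = v t j" if "j < r" for t j
      using that r by (simp add: link v_def)
    then have "pc_residual M y r \<phi> t u = (\<Sum>j<?n. v t j *\<^sub>R \<phi> j u) - (\<Sum>j<r. v t j *\<^sub>R \<phi> j u)" for t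
      unfolding pc_residual_def elim[rule_format, of t] by simp
    then show ?case unfolding split by simp
  qed
  have cls: "AE u in M. \<forall>t. cls_residual y Q \<Gamma> t u = (\<Sum>j=r..<?n. v t j *\<^sub>R \<phi> j u)"
    using yexp qexp
  proof eventually_elim
    case (elim u)
    \<comment> \<open>Summing \<open>\<Gamma> $ t $ k * q k j\<close> over \<open>k\<close>
      reassembles coordinate \<open>t\<close> of the projection of \<open>w j\<close>, times
      \<open>sqrt (n * \<tau> j)\<close>.\<close>
    have "Q u *v (\<Gamma> $ t) = (\<Sum>j<r. v t j *\<^sub>R \<phi> j u)" for t
    proof -
      have "Q u *v (\<Gamma> $ t) = (\<Sum>k\<in>UNIV. \<Sum>j<?n. (\<Gamma> $ t $ k * q k j) *\<^sub>R \<phi> j u)"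
        using elim(2) by (simp add: matrix_vector_mult_columns scaleR_sum_right)
      also have "\<dots> = (\<Sum>j<?n. \<Sum>k\<in>UNIV. (\<Gamma> $ t $ k * q k j) *\<^sub>R \<phi> j u)" by (rule sum.swap)
      also have "\<dots> = (\<Sum>j<?n. (if j < r then v t j else 0) *\<^sub>R \<phi> j u)"
      proof (intro sum.cong refl)
        fix j assume "j \<in> {..<?n}"
        then have "sqrt (real ?n) * (sqrt (\<tau> j) *\<^sub>R span_proj ?g (w j)) $ t = (if j < r then v t j else 0)"
          using sproj[of j] by (simp add: v_def real_sqrt_mult)
        moreover have "\<Gamma> $ t $ k = sqrt (real ?n) * ?g k $ t" for k
          by (simp add: cls_score_def column_def)
        ultimately show "(\<Sum>k\<in>UNIV. (\<Gamma> $ t $ k * q k j) *\<^sub>R \<phi> j u) = (if j < r then v t j else 0) *\<^sub>R \<phi> j u"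
          by (simp add: scaleR_sum_left[symmetric] q_def span_proj_def sum_distrib_left mult_ac)
      qed
      also have "\<dots> = (\<Sum>j<r. v t j *\<^sub>R \<phi> j u)" unfolding split by simp
      finally show ?thesis .
    qed
    then have "cls_residual y Q \<Gamma> t u = (\<Sum>j<?n. v t j *\<^sub>R \<phi> j u) - (\<Sum>j<r. v t j *\<^sub>R \<phi> j u)" for t
      unfolding cls_residual_def elim(1)[rule_format, of t] by simp
    then show ?case unfolding split by simp
  qed
  have pc_cls: "AE u in M. pc_residual M y r \<phi> t u = cls_residual y Q \<Gamma> t u" for t
    using pc cls by eventually_elim simp
  have pcL2: "pc_residual M y r \<phi> t \<in> L2 M" for t
    unfolding pc_residual_def[abs_def] by (intro L2_diff L2_lincomb y phi)
  have clsL2: "cls_residual y Q \<Gamma> t \<in> L2 M" for t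
    unfolding cls_residual_def[abs_def] matrix_vector_mult_columns
    by (intro L2_diff L2_lincomb L2_column y Q)
  have cov: "kernel_eq M (orth_complement r \<tau> \<phi>) (sample_cov (cls_residual y Q \<Gamma>))"
    unfolding kernel_eq_def
    using AE_pair_fst[OF cls] AE_pair_snd[OF cls]
  proof eventually_elim
    case (elim z)
    have "(\<Sum>t\<in>UNIV. v t i * v t j) = (if i = j \<and> i \<in> {r..<?n} then real ?n * \<tau> i else 0)"
      if "i \<in> {r..<?n}" "j \<in> {r..<?n}" for i j
    proof -
      have "(\<Sum>t\<in>UNIV. v t i * v t j) = sqrt (real ?n * \<tau> i) * sqrt (real ?n * \<tau> j) * (w i \<bullet> w j)"
        by (simp add: v_def inner_vec_def sum_distrib_left mult_ac)
      then show ?thesis using that tau[of j] by (auto simp: ww)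
    qed
    then have "(\<Sum>t\<in>UNIV. outer (\<Sum>j=r..<?n. v t j *\<^sub>R \<phi> j (fst z)) (\<Sum>j=r..<?n. v t j *\<^sub>R \<phi> j (snd z))) =
        (\<Sum>j=r..<?n. (real ?n * \<tau> j) *\<^sub>R outer (\<phi> j (fst z)) (\<phi> j (snd z)))"
      by (intro sum_outer_lincomb_diagonal) auto
    then have "sample_cov (cls_residual y Q \<Gamma>) z = (\<Sum>j=r..<?n. \<tau> j *\<^sub>R outer (\<phi> j (fst z)) (\<phi> j (snd z)))"
      unfolding sample_cov_def case_prod_beta' elim(1,2)[rule_format]
      by (simp only:) (simp add: scaleR_sum_right)
    then show ?case
      using orth_complement_finite[of ?n \<tau> r \<phi> "fst z" "snd z", OF tau0] by simp
  qed
  have lead: "AE z in M \<Otimes>\<^sub>M M. leading_part r \<tau> \<phi> z = Q (fst z) ** transpose (Q (snd z))"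
    using AE_pair_fst[OF qexp] AE_pair_snd[OF qexp]
  proof eventually_elim
    case (elim z)
    \<comment> \<open>This is the matrix of the projection in the basis \<open>w\<close>, scaled by
      square roots of eigenvalues; \<open>proj\<close> makes it diagonal and cuts it off at
      \<open>r\<close>.\<close>
    have "(\<Sum>k\<in>UNIV. q k i * q k j) = (if i = j \<and> i \<in> {..<r} then \<tau> i else 0)"
      if "i \<in> {..<?n}" "j \<in> {..<?n}" for i j
    proof -
      have "(\<Sum>k\<in>UNIV. q k i * q k j) = sqrt (\<tau> i) * (w i \<bullet> (sqrt (\<tau> j) *\<^sub>R span_proj ?g (w j)))"
        by (simp add: q_def span_proj_def inner_sum_right sum_distrib_left mult_ac inner_commute)
      also have "\<dots> = sqrt (\<tau> i) * (w i \<bullet> (if j < r then sqrt (\<tau> j) *\<^sub>R w j else 0))"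
        using sproj[of j] that by simp
      finally show ?thesis using that tau[of j] by (auto simp: ww)
    qed
    then have "(\<Sum>k\<in>UNIV. outer (\<Sum>j<?n. q k j *\<^sub>R \<phi> j (fst z)) (\<Sum>j<?n. q k j *\<^sub>R \<phi> j (snd z))) =
        (\<Sum>j<r. \<tau> j *\<^sub>R outer (\<phi> j (fst z)) (\<phi> j (snd z)))"
      using r by (intro sum_outer_lincomb_diagonal) auto
    then show ?case
      using elim by (simp add: leading_part_def case_prod_beta' matrix_mult_transpose_columns)
  qed
  have S: "(\<lambda>z. orth_complement r \<tau> \<phi> z $ i $ j) \<in> L2 (M \<Otimes>\<^sub>M M)" for i j
  proof -
    have "(\<lambda>z. orth_complement r \<tau> \<phi> z $ i $ j) = (\<lambda>z. \<Sum>l=r..<?n. \<tau> l * (\<phi> l (fst z) $ i * \<phi> l (snd z) $ j))"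
    proof
      fix z
      show "orth_complement r \<tau> \<phi> z $ i $ j = (\<Sum>l=r..<?n. \<tau> l * (\<phi> l (fst z) $ i * \<phi> l (snd z) $ j))"
        using orth_complement_finite[of ?n \<tau> r \<phi> "fst z" "snd z", OF tau0] by (simp add: outer_def)
    qed
    then show ?thesis
      by (simp only:) (rule L2_kernel_entry[where f = \<phi> and g = \<phi>]; rule phi)
  qed
  have S': "(\<lambda>z. sample_cov (cls_residual y Q \<Gamma>) z $ i $ j) \<in> L2 (M \<Otimes>\<^sub>M M)" for i j
  proof -
    have "(\<lambda>z. sample_cov (cls_residual y Q \<Gamma>) z $ i $ j) = (\<lambda>z. \<Sum>t\<in>UNIV. (1 / real ?n) *
        (cls_residual y Q \<Gamma> t (fst z) $ i * cls_residual y Q \<Gamma> t (snd z) $ j))"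
      by (simp add: sample_cov_def outer_def case_prod_beta' sum_divide_distrib)
    then show ?thesis
      by (simp only:) (rule L2_kernel_entry[where f = "cls_residual y Q \<Gamma>" and g = "cls_residual y Q \<Gamma>"]; rule clsL2)
  qed
  have R: "kernel_eq M (fpoet_R_AFT M s y r \<tau> \<phi>) (cls_error_AFT M s y Q \<Gamma>)"
    unfolding fpoet_R_AFT_def cls_error_AFT_def
    by (rule AFT_cong[OF M s pcL2 clsL2 pc_cls S S' cov])
  moreover have "kernel_eq M (fpoet M s y r \<tau> \<phi>) (cls_estimator M s y Q \<Gamma>)"
    using lead R unfolding kernel_eq_def
    by eventually_elim (simp add: fpoet_def cls_estimator_def case_prod_beta')
  ultimately show ?thesis by blast
qed

text \<open>Eigenfunctions and minimizers are fixed only up to choices, and when an eigenvalue is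
  repeated across position \<open>r\<close>, independent choices need not correspond to each other.
  Hence three parts: under a spectral gap all choices agree, and in general each eigensystem is
  matched by a minimizer and each minimizer by an eigensystem. A tie at eigenvalue 0 is harmless, as
  the corresponding loadings vanish.\<close>

theorem proposition3:
  fixes a b C lam :: real
    and M :: "real measure"
    and y :: "'n::finite \<Rightarrow> real \<Rightarrow> real^'p::finite"
    and s :: "(real \<times> real \<Rightarrow> real) \<Rightarrow> real \<times> real \<Rightarrow> real"
    and r :: nat
  assumes "a < b" and M: "M = lebesgue_on {a..b}"
    and y: "\<And>t. y t \<in> L2 M"
    and r: "r = CARD('r::finite)" "r \<le> CARD('n)"
    and "C > 0"
    and lam: "lam = C * (sqrt (ln (real CARD('p)) / real CARD('n)) + 1 / sqrt (real CARD('p)))"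
    and s: "functional_thresholding M lam s"
  shows
    "(\<forall>\<tau> \<phi> (Q :: real \<Rightarrow> real^'r^'p) \<Gamma>.
        eigensystem M (sample_cov y) \<tau> \<phi> \<and> cls_solution M y Q \<Gamma> \<and>
        (\<forall>j<r. 0 < \<tau> j \<longrightarrow> \<tau> r < \<tau> j) \<longrightarrow>
        kernel_eq M (fpoet M s y r \<tau> \<phi>) (cls_estimator M s y Q \<Gamma>) \<and>
        kernel_eq M (fpoet_R_AFT M s y r \<tau> \<phi>) (cls_error_AFT M s y Q \<Gamma>)) \<and>
     (\<forall>\<tau> \<phi>. eigensystem M (sample_cov y) \<tau> \<phi> \<longrightarrow>
        (\<exists>(Q :: real \<Rightarrow> real^'r^'p) \<Gamma>. cls_solution M y Q \<Gamma> \<and>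
           kernel_eq M (fpoet M s y r \<tau> \<phi>) (cls_estimator M s y Q \<Gamma>) \<and>
           kernel_eq M (fpoet_R_AFT M s y r \<tau> \<phi>) (cls_error_AFT M s y Q \<Gamma>))) \<and>
     (\<forall>(Q :: real \<Rightarrow> real^'r^'p) \<Gamma>. cls_solution M y Q \<Gamma> \<longrightarrow>
        (\<exists>\<tau> \<phi>. eigensystem M (sample_cov y) \<tau> \<phi> \<and>
           kernel_eq M (fpoet M s y r \<tau> \<phi>) (cls_estimator M s y Q \<Gamma>) \<and>
           kernel_eq M (fpoet_R_AFT M s y r \<tau> \<phi>) (cls_error_AFT M s y Q \<Gamma>)))"
proof -
  interpret finite_measure M
    unfolding M by (rule finite_measure_lebesgue_on) simp
  have \<sigma>: "sigma_finite_measure M" by unfold_locales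
  have sym: "gram M y x \<bullet> z = x \<bullet> gram M y z" for x z by (rule gram_symmetric) (rule y)
  have psd: "0 \<le> x \<bullet> gram M y x" for x by (rule gram_nonneg) (rule y)
  have r': "r \<le> DIM(real^'n)" using r(2) by simp
  note match = fpoet_eq_cls[where y = y, OF \<sigma> s y r(2)]
  show ?thesis
  proof (intro conjI[of "All _"] allI impI)
    fix \<tau> \<phi> and Q :: "real \<Rightarrow> real^'r^'p" and \<Gamma>
    assume *: "eigensystem M (sample_cov y) \<tau> \<phi> \<and> cls_solution M y Q \<Gamma> \<and> (\<forall>j<r. 0 < \<tau> j \<longrightarrow> \<tau> r < \<tau> j)"
    then have es: "eigensystem M (sample_cov y) \<tau> \<phi>" and sol: "cls_solution M y Q \<Gamma>"
      and gap: "\<And>j. j < r \<Longrightarrow> 0 < \<tau> j \<Longrightarrow> \<tau> r < \<tau> j" by auto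
    obtain w where basis: "sorted_eigenbasis (gram M y) \<tau> w"
      and link: "\<And>j t. j < CARD('n) \<Longrightarrow> L2_inner M (y t) (\<phi> j) = sqrt (real CARD('n) * \<tau> j) * w j $ t"
      using eigensystem_gram_eigenbasis[where y = y, OF y es] by blast
    note opt = cls_solution_optimality[where y = y, OF y sol basis r]
    have kf: "(\<tau> r < \<tau> j \<longrightarrow> span_proj (cls_score \<Gamma>) (w j) = w j) \<and>
        (\<tau> j < \<tau> r \<longrightarrow> span_proj (cls_score \<Gamma>) (w j) = 0)" if "j < CARD('n)" for j
      using ky_fan_eq[OF basis sym opt(1) r(1) r' opt(3), of j] that by simp
    have "span_proj (cls_score \<Gamma>) (w j) = (if j < r then w j else 0)" if j: "j < CARD('n)" "0 < \<tau> j" for j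
    proof (cases "j < r")
      case True
      then show ?thesis using kf[OF j(1)] gap[OF True j(2)] by simp
    next
      case False
      \<comment> \<open>A positive eigenvalue at or beyond position \<open>r\<close> forces all
        leading ones to be positive. The gap then applies to each of them, the projection fixes the
        \<open>r\<close> leading vectors, and its rank leaves nothing for
        \<open>w j\<close>.\<close>
      have "decseq \<tau>" using es by (simp add: eigensystem_def)
      then have "0 < \<tau> i" if "i < r" for i
        using j(2) decseqD[of \<tau> i j] that False by linarith
      then have "span_proj (cls_score \<Gamma>) (w i) = w i" if "i < r" for i
        using kf[of i] gap[of i] that r(2) by simp
      then have "span_proj (cls_score \<Gamma>) (w j) = 0"
        using False j(1) by (intro span_proj_eq_0_of_leading[OF basis opt(1) r(1)]) auto
      then show ?thesis using False by simp
    qed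
    then show "kernel_eq M (fpoet M s y r \<tau> \<phi>) (cls_estimator M s y Q \<Gamma>) \<and>
        kernel_eq M (fpoet_R_AFT M s y r \<tau> \<phi>) (cls_error_AFT M s y Q \<Gamma>)"
      using match[OF es basis link opt(2,1,4)] by blast
  next
    fix \<tau> \<phi>
    assume es: "eigensystem M (sample_cov y) \<tau> \<phi>"
    obtain w where basis: "sorted_eigenbasis (gram M y) \<tau> w"
      and link: "\<And>j t. j < CARD('n) \<Longrightarrow> L2_inner M (y t) (\<phi> j) = sqrt (real CARD('n) * \<tau> j) * w j $ t"
      using eigensystem_gram_eigenbasis[where y = y, OF y es] by blast
    obtain Q :: "real \<Rightarrow> real^'r^'p" and \<Gamma> :: "real^'r^'n" where sol: "cls_solution M y Q \<Gamma>"
      and proj: "\<And>j. j < CARD('n) \<Longrightarrow> span_proj (cls_score \<Gamma>) (w j) = (if j < r then w j else 0)"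
      using cls_solution_of_eigenbasis[where y = y, OF y basis r] by blast
    note opt = cls_solution_optimality[where y = y, OF y sol basis r]
    show "\<exists>(Q :: real \<Rightarrow> real^'r^'p) \<Gamma>. cls_solution M y Q \<Gamma> \<and>
           kernel_eq M (fpoet M s y r \<tau> \<phi>) (cls_estimator M s y Q \<Gamma>) \<and>
           kernel_eq M (fpoet_R_AFT M s y r \<tau> \<phi>) (cls_error_AFT M s y Q \<Gamma>)"
      using sol match[OF es basis link opt(2,1,4) proj] by blast
  next
    fix Q :: "real \<Rightarrow> real^'r^'p" and \<Gamma>
    assume sol: "cls_solution M y Q \<Gamma>"
    \<comment> \<open>Any sorted eigenbasis serves to read off the consequences of optimality; one
      adapted to the minimizer then replaces it.\<close>
    obtain \<tau>\<^sub>0 w\<^sub>0 where basis0: "sorted_eigenbasis (gram M y) \<tau>\<^sub>0 w\<^sub>0"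
      using sorted_eigenbasis_exists[OF linear_gram sym psd] by blast
    note opt = cls_solution_optimality[where y = y, OF y sol basis0 r]
    obtain \<tau> w where basis: "sorted_eigenbasis (gram M y) \<tau> w"
      and proj: "\<And>j. j < CARD('n) \<Longrightarrow> span_proj (cls_score \<Gamma>) (w j) = (if j < r then w j else 0)"
      using sorted_eigenbasis_adapted[OF linear_gram sym psd basis0 opt(1) r(1) r' opt(3)] by auto
    \<comment> \<open>Since \<open>a < b\<close>, the space is infinite-dimensional, which provides
      eigenfunctions for eigenvalue 0 that are orthogonal to all observations.\<close>
    obtain h :: "nat \<Rightarrow> real \<Rightarrow> real^'p" where "\<And>k. h k \<in> L2 M"
      "\<And>i j. L2_inner M (h i) (h j) = (if i = j then 1 else 0)"
      using L2_orthonormal_sequence_lebesgue_on[OF \<open>a < b\<close>] unfolding M by blast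
    then obtain e :: "nat \<Rightarrow> real \<Rightarrow> real^'p" where e: "\<And>k. e k \<in> L2 M"
      "\<And>i j. L2_inner M (e i) (e j) = (if i = j then 1 else 0)" "\<And>k t. L2_inner M (y t) (e k) = 0"
      using L2_orthonormal_sequence_orthogonal_to[where y = y and h = h, OF y] by blast
    obtain \<phi> where es: "eigensystem M (sample_cov y) \<tau> \<phi>"
      and link: "\<And>j t. j < CARD('n) \<Longrightarrow> L2_inner M (y t) (\<phi> j) = sqrt (real CARD('n) * \<tau> j) * w j $ t"
      using gram_eigenbasis_eigensystem[where y = y and e = e, OF y basis e] by blast
    show "\<exists>\<tau> \<phi>. eigensystem M (sample_cov y) \<tau> \<phi> \<and>
           kernel_eq M (fpoet M s y r \<tau> \<phi>) (cls_estimator M s y Q \<Gamma>) \<and>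
           kernel_eq M (fpoet_R_AFT M s y r \<tau> \<phi>) (cls_error_AFT M s y Q \<Gamma>)"
      using es match[OF es basis link opt(2,1,4) proj] by blast
  qed
qed

end
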